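(* Let $p\in(2,\infty]$, $q\in[2,\infty]$, and let $r_1,r_2>0$ be real numbers. Write $$M_n:=\sup_{T\in\mathscr{B}^{n}_{p,q}}\left(\sum_{i=1}^{n}\left(\sum_{j=1}^{n}|T(e_{i},e_{j})|^{r_{1}}\right)^{\frac{1}{r_{1}}\cdot r_{2}}\right)^{\frac{1}{r_{2}}}.$$ (i) If $(r_1,r_2)$ is in (R1) or in (R2), then $$M_n=O\left(n^{\frac{1}{r_{1}}+\frac{1}{r_{2}}-\left(\frac{3}{2}-\left(\frac{1}{p}+\frac{1}{q}\right)\right)}\right),$$ and the exponent $\frac{1}{r_{1}}+\frac{1}{r_{2}}-\left(\frac{3}{2}-\left(\frac{1}{p}+\frac{1}{q}\right)\right)$ is optimal. (ii) If $(r_1,r_2)$ is in (R3), then $$M_n=O\left(n^{\frac{1}{r_{1}}-\frac{1}{q^{\ast}}}\right),$$ and the exponent $\frac{1}{r_{1}}-\frac{1}{q^{\ast}}$ is optimal. (iii) If $(r_1,r_2)$ is in (R4), then $$M_n=O\left(n^{\frac{1}{r_{2}}-\frac{pq-p-q}{pq}}\right),$$ and the exponent $\frac{1}{r_{2}}-\frac{pq-p-q}{pq}$ is optimal.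
   Context: $\mathbb{K}$ is $\mathbb{R}$ or $\mathbb{C}$; $\ell_p^n$ is $\mathbb{K}^n$ with the $\ell_p$ norm; $e_i$ are the canonical unit vectors. $\mathscr{B}^n_{p,q}$ is the set of bilinear forms $T\colon\ell_p^n\times\ell_q^n\to\mathbb{K}$ with $\|T\|=1$ (usual sup norm). $q^*$ is the conjugate exponent of $q$ ($\frac1q+\frac1{q^*}=1$, $\infty^*=1$). When $p$ or $q$ is infinite, $\frac{2p}{p-2}$, $\frac{pq}{pq-p-q}$ and $\frac{pq-p-q}{pq}$ are read as $\left(\frac12-\frac1p\right)^{-1}$, $\left(1-\frac1p-\frac1q\right)^{-1}$ and $1-\frac1p-\frac1q$, with $\frac1\infty=0$. The regions are: (R1): $q^*\le r_1\le 2$ and $\frac1{r_1}+\frac1{r_2}>\frac32-\left(\frac1p+\frac1q\right)$. (R2): $r_1<q^*$ and $r_2<\frac{2p}{p-2}$. (R3): $r_1<q^*$ and $r_2>\frac{2p}{p-2}$. (R4): $r_1>2$ and $r_2<\frac{pq}{pq-p-q}$. $O(\cdot)$ refers to $n\to\infty$ with $p,q,r_1,r_2$ fixed. An exponent $t_0$ is optimal if it cannot be improved: whenever $t\in\mathbb{R}$ is such that $M_n=O(n^t)$, then $t\ge t_0$. *)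

theory Defs
  imports "HOL-Analysis.Analysis" "HOL-Library.Landau_Symbols"
begin

text \<open>
  The dimension \<open>n\<close> tends to infinity, so the space of \<open>n\<close>-tuples of scalars is given by an explicit carrier: the sequences
  that vanish outside \<open>{1..n}\<close>. Exponents in \<open>[1,\<infinity>]\<close> have type \<open>ereal\<close>, where \<open>1 / \<infinity> = 0\<close>.
\<close>

definition Kspace :: "nat \<Rightarrow> (nat \<Rightarrow> 'k::real_normed_field) set" where
  "Kspace n = {x. \<forall>i. i \<notin> {1..n} \<longrightarrow> x i = 0}"

definition unit_vec :: "nat \<Rightarrow> nat \<Rightarrow> 'k::real_normed_field" where
  "unit_vec i = (\<lambda>k. if k = i then 1 else 0)"

definition recip :: "ereal \<Rightarrow> real" where
  "recip p = real_of_ereal (1 / p)"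

definition conj_exponent :: "ereal \<Rightarrow> ereal" where
  "conj_exponent q = 1 / (1 - 1 / q)"

text \<open>The element \<open>0\<close> inserted below only serves to make the maximum meaningful for \<open>n = 0\<close>.\<close>

definition lp_norm :: "ereal \<Rightarrow> nat \<Rightarrow> (nat \<Rightarrow> 'k::real_normed_field) \<Rightarrow> real" where
  "lp_norm p n x =
     (if p = \<infinity> then Max (insert 0 ((\<lambda>i. norm (x i)) ` {1..n}))
      else (\<Sum>i=1..n. norm (x i) powr real_of_ereal p) powr (1 / real_of_ereal p))"

definition bilinear_form ::
    "nat \<Rightarrow> ((nat \<Rightarrow> 'k::real_normed_field) \<Rightarrow> (nat \<Rightarrow> 'k) \<Rightarrow> 'k) \<Rightarrow> bool" where
  "bilinear_form n T \<longleftrightarrow>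
     (\<forall>x\<in>Kspace n. \<forall>x'\<in>Kspace n. \<forall>y\<in>Kspace n. T (\<lambda>i. x i + x' i) y = T x y + T x' y) \<and>
     (\<forall>x\<in>Kspace n. \<forall>y\<in>Kspace n. \<forall>y'\<in>Kspace n. T x (\<lambda>i. y i + y' i) = T x y + T x y') \<and>
     (\<forall>c. \<forall>x\<in>Kspace n. \<forall>y\<in>Kspace n. T (\<lambda>i. c * x i) y = c * T x y) \<and>
     (\<forall>c. \<forall>x\<in>Kspace n. \<forall>y\<in>Kspace n. T x (\<lambda>i. c * y i) = c * T x y)"

text \<open>
  For \<open>p, q \<ge> 1\<close> and bilinear \<open>T\<close> the following supremum is taken over a nonempty bounded set
  of reals.
\<close>

definition form_norm ::
    "ereal \<Rightarrow> ereal \<Rightarrow> nat \<Rightarrow> ((nat \<Rightarrow> 'k::real_normed_field) \<Rightarrow> (nat \<Rightarrow> 'k) \<Rightarrow> 'k) \<Rightarrow> real" where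
  "form_norm p q n T =
     Sup {norm (T x y) | x y. x \<in> Kspace n \<and> y \<in> Kspace n \<and> lp_norm p n x \<le> 1 \<and> lp_norm q n y \<le> 1}"

definition unit_forms ::
    "ereal \<Rightarrow> ereal \<Rightarrow> nat \<Rightarrow> ((nat \<Rightarrow> 'k::real_normed_field) \<Rightarrow> (nat \<Rightarrow> 'k) \<Rightarrow> 'k) set" where
  "unit_forms p q n = {T. bilinear_form n T \<and> form_norm p q n T = 1}"

definition mixed_sum ::
    "real \<Rightarrow> real \<Rightarrow> nat \<Rightarrow> ((nat \<Rightarrow> 'k::real_normed_field) \<Rightarrow> (nat \<Rightarrow> 'k) \<Rightarrow> 'k) \<Rightarrow> real" where
  "mixed_sum r\<^sub>1 r\<^sub>2 n T =
     (\<Sum>i=1..n. (\<Sum>j=1..n. norm (T (unit_vec i) (unit_vec j)) powr r\<^sub>1) powr (1 / r\<^sub>1 * r\<^sub>2))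
       powr (1 / r\<^sub>2)"

text \<open>
  The token of type \<open>'k itself\<close> selects the scalar field. For \<open>n \<ge> 1\<close> the supremum is over a
  nonempty set, bounded because \<open>norm (T (unit_vec i) (unit_vec j)) \<le> form_norm p q n T = 1\<close>.
  For \<open>n = 0\<close> there is no form of norm one and the value is irrelevant to the asymptotics.
\<close>

definition M_sup ::
    "'k::real_normed_field itself \<Rightarrow> ereal \<Rightarrow> ereal \<Rightarrow> real \<Rightarrow> real \<Rightarrow> nat \<Rightarrow> real" where
  "M_sup _ p q r\<^sub>1 r\<^sub>2 n =
     (SUP T \<in> (unit_forms p q n :: ((nat \<Rightarrow> 'k) \<Rightarrow> (nat \<Rightarrow> 'k) \<Rightarrow> 'k) set). mixed_sum r\<^sub>1 r\<^sub>2 n T)"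

definition power_bound :: "(nat \<Rightarrow> real) \<Rightarrow> real \<Rightarrow> bool" where
  "power_bound M t \<longleftrightarrow> M \<in> O(\<lambda>n. real n powr t)"

definition optimal_exponent :: "(nat \<Rightarrow> real) \<Rightarrow> real \<Rightarrow> bool" where
  "optimal_exponent M t\<^sub>0 \<longleftrightarrow> (\<forall>t. power_bound M t \<longrightarrow> t\<^sub>0 \<le> t)"

text \<open>
  Below, \<open>2p/(p-2)\<close> is written \<open>1 / (1/2 - 1/p)\<close> and \<open>pq/(pq-p-q)\<close> is written
  \<open>1 / (1 - 1/p - 1/q)\<close>, which also covers infinite \<open>p\<close> or \<open>q\<close>. Both denominators are
  positive for \<open>p > 2\<close> and \<open>q \<ge> 2\<close>.
\<close>

definition region_R1 :: "ereal \<Rightarrow> ereal \<Rightarrow> real \<Rightarrow> real \<Rightarrow> bool" where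
  "region_R1 p q r\<^sub>1 r\<^sub>2 \<longleftrightarrow>
     conj_exponent q \<le> ereal r\<^sub>1 \<and> r\<^sub>1 \<le> 2 \<and> 1 / r\<^sub>1 + 1 / r\<^sub>2 > 3 / 2 - (recip p + recip q)"

definition region_R2 :: "ereal \<Rightarrow> ereal \<Rightarrow> real \<Rightarrow> real \<Rightarrow> bool" where
  "region_R2 p q r\<^sub>1 r\<^sub>2 \<longleftrightarrow> ereal r\<^sub>1 < conj_exponent q \<and> r\<^sub>2 < 1 / (1 / 2 - recip p)"

definition region_R3 :: "ereal \<Rightarrow> ereal \<Rightarrow> real \<Rightarrow> real \<Rightarrow> bool" where
  "region_R3 p q r\<^sub>1 r\<^sub>2 \<longleftrightarrow> ereal r\<^sub>1 < conj_exponent q \<and> r\<^sub>2 > 1 / (1 / 2 - recip p)"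

definition region_R4 :: "ereal \<Rightarrow> ereal \<Rightarrow> real \<Rightarrow> real \<Rightarrow> bool" where
  "region_R4 p q r\<^sub>1 r\<^sub>2 \<longleftrightarrow> r\<^sub>1 > 2 \<and> r\<^sub>2 < 1 / (1 - recip p - recip q)"

end

theory Submission
  imports Defs
begin

text \<open>
  Put \<open>a = 1/p\<close>, \<open>b = 1/q\<close> and \<open>c\<^sub>i\<^sub>j = T (e\<^sub>i, e\<^sub>j)\<close>. Inserting random signs in one variable and using
  Khinchine's inequality together with \<open>\<ell>\<^sub>q\<close>-duality in the other shows that the square functions
  \<open>(\<Sum>\<^sub>i |x\<^sub>i c\<^sub>i\<^sub>j|\<^sup>2)\<^bsup>1/2\<^esup>\<close> are bounded in \<open>\<ell>\<^bsub>q*\<^esub>\<close> uniformly in the unit ball of \<open>\<ell>\<^sub>p\<close>, and symmetrically.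
  These two facts bound the mixed norm at the exponents \<open>(q*, 1/(1/2 - a))\<close> (one Hoelder
  inequality) and \<open>(2, 1/(1 - a - b))\<close> (the argument of Hardy and Littlewood). Interpolation gives the
  segment in between, where \<open>1/r\<^sub>1 + 1/r\<^sub>2 = 3/2 - a - b\<close>, and every region is reached from a point of this
  segment by the inclusions between the finite-dimensional spaces \<open>\<ell>\<^sub>r\<close>. Optimality is seen on Hadamard
  matrices for (R1) and (R2), on \<open>x\<^sub>1 (y\<^sub>1 + \<dots> + y\<^sub>n)\<close> for (R3), and on \<open>\<Sum>\<^sub>i x\<^sub>i y\<^sub>i\<close> for (R4).
\<close>

subsection \<open>Sums of powers\<close>

definition lnorm :: "real \<Rightarrow> 'i set \<Rightarrow> ('i \<Rightarrow> real) \<Rightarrow> real" where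
  "lnorm r I f = (\<Sum>i\<in>I. f i powr r) powr (1 / r)"

text \<open>Young's inequality is applied termwise after dividing \<open>f\<close> and
  \<open>g\<close> by their sums. The endpoints \<open>\<theta> = 0\<close> and
  \<open>\<theta> = 1\<close> are covered because \<open>0 powr 0 = 0\<close>, so a term with a zero
  entry vanishes.\<close>

lemma sum_powr_Hoelder:
  fixes f g :: "'i \<Rightarrow> real"
  assumes fin: "finite I" and f: "\<And>i. i \<in> I \<Longrightarrow> 0 \<le> f i" and g: "\<And>i. i \<in> I \<Longrightarrow> 0 \<le> g i"
    and \<theta>: "0 \<le> \<theta>" "\<theta> \<le> 1"
  shows "(\<Sum>i\<in>I. f i powr \<theta> * g i powr (1 - \<theta>)) \<le> sum f I powr \<theta> * sum g I powr (1 - \<theta>)"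
proof (cases "sum f I = 0 \<or> sum g I = 0")
  case True
  then have "(\<forall>i\<in>I. f i = 0) \<or> (\<forall>i\<in>I. g i = 0)"
    using sum_nonneg_eq_0_iff[OF fin] f g by metis
  then have "(\<Sum>i\<in>I. f i powr \<theta> * g i powr (1 - \<theta>)) = 0"
    by (intro sum.neutral) auto
  then show ?thesis by simp
next
  case False
  define F G where "F = sum f I" and "G = sum g I"
  have pos: "F > 0" "G > 0"
    using False f g sum_nonneg[of I f] sum_nonneg[of I g] unfolding F_def G_def by force+
  have "f i powr \<theta> * g i powr (1 - \<theta>) \<le> (F powr \<theta> * G powr (1 - \<theta>)) * (\<theta> * (f i / F) + (1 - \<theta>) * (g i / G))"
    if "i \<in> I" for i
  proof (cases "f i = 0 \<or> g i = 0")
    case True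
    then show ?thesis using pos \<theta> f[OF that] g[OF that]
      by (auto intro!: mult_nonneg_nonneg)
  next
    case False
    then have "(f i / F) powr \<theta> * (g i / G) powr (1 - \<theta>) \<le> \<theta> * (f i / F) + (1 - \<theta>) * (g i / G)"
      using Youngs_inequality_0[of \<theta> "1 - \<theta>" "f i / F" "g i / G"] \<theta> pos f[OF that] g[OF that]
      by auto
    then show ?thesis using pos by (simp add: powr_divide field_simps)
  qed
  then have "(\<Sum>i\<in>I. f i powr \<theta> * g i powr (1 - \<theta>))
      \<le> (\<Sum>i\<in>I. (F powr \<theta> * G powr (1 - \<theta>)) * (\<theta> * (f i / F) + (1 - \<theta>) * (g i / G)))"
    by (rule sum_mono)
  also have "\<dots> = (F powr \<theta> * G powr (1 - \<theta>)) * (\<theta> * (F / F) + (1 - \<theta>) * (G / G))"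
    by (simp add: F_def G_def sum_distrib_left[symmetric] sum.distrib sum_divide_distrib[symmetric])
  also have "\<dots> = F powr \<theta> * G powr (1 - \<theta>)" using pos by simp
  finally show ?thesis by (simp add: F_def G_def)
qed

lemma sum_powr_le_card:
  fixes f :: "'i \<Rightarrow> real"
  assumes "finite I" and "\<And>i. i \<in> I \<Longrightarrow> 0 \<le> f i" and "0 \<le> \<theta>" "\<theta> \<le> 1"
  shows "(\<Sum>i\<in>I. f i powr \<theta>) \<le> real (card I) powr (1 - \<theta>) * sum f I powr \<theta>"
  using sum_powr_Hoelder[of I f "\<lambda>_. 1" \<theta>] assms by (simp add: mult.commute)

text \<open>Each \<open>f i\<close> is at most the whole sum, so its factor
  \<open>f i powr (\<theta> - 1)\<close> may be replaced by the same power of the sum.\<close>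

lemma sum_powr_le_powr_sum:
  fixes f :: "'i \<Rightarrow> real"
  assumes fin: "finite I" and f: "\<And>i. i \<in> I \<Longrightarrow> 0 \<le> f i" and \<theta>: "1 \<le> \<theta>"
  shows "(\<Sum>i\<in>I. f i powr \<theta>) \<le> sum f I powr \<theta>"
proof -
  have "f i powr \<theta> \<le> f i * sum f I powr (\<theta> - 1)" if "i \<in> I" for i
  proof -
    have "f i powr (\<theta> - 1) \<le> sum f I powr (\<theta> - 1)"
      using \<theta> f[OF that] member_le_sum[of i I f] that f fin by (intro powr_mono2) auto
    then have "f i * f i powr (\<theta> - 1) \<le> f i * sum f I powr (\<theta> - 1)"
      using f[OF that] by (rule mult_left_mono)
    then show ?thesis using f[OF that] by (simp add: powr_mult_base)
  qed
  then have "(\<Sum>i\<in>I. f i powr \<theta>) \<le> (\<Sum>i\<in>I. f i * sum f I powr (\<theta> - 1))"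
    by (rule sum_mono)
  also have "\<dots> = sum f I * sum f I powr (\<theta> - 1)" by (simp add: sum_distrib_right)
  also have "\<dots> = sum f I powr \<theta>" using f by (simp add: powr_mult_base sum_nonneg)
  finally show ?thesis .
qed

text \<open>Concavity of the power \<open>\<kappa>\<close> against unnormalised weights
  \<open>t\<close>. It follows from Hoelder after splitting \<open>t\<close> into its powers
  \<open>\<kappa>\<close> and \<open>1 - \<kappa>\<close>.\<close>

lemma sum_mult_powr_Jensen:
  fixes t y :: "'i \<Rightarrow> real"
  assumes "finite I" and "\<And>i. i \<in> I \<Longrightarrow> 0 \<le> t i" and "\<And>i. i \<in> I \<Longrightarrow> 0 \<le> y i"
    and "0 \<le> \<kappa>" "\<kappa> \<le> 1"
  shows "(\<Sum>i\<in>I. t i * y i powr \<kappa>) \<le> (\<Sum>i\<in>I. t i * y i) powr \<kappa> * sum t I powr (1 - \<kappa>)"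
proof -
  have "t i * y i powr \<kappa> = (t i * y i) powr \<kappa> * t i powr (1 - \<kappa>)" if "i \<in> I" for i
    using assms(2)[OF that] by (simp add: powr_mult powr_diff)
  then show ?thesis
    using sum_powr_Hoelder[of I "\<lambda>i. t i * y i" t \<kappa>] assms by simp
qed

lemma powr_le_imp_le_powr_inverse:
  fixes x y :: real
  assumes "x powr e \<le> y" "0 < e" "0 \<le> x"
  shows "x \<le> y powr (1 / e)"
proof -
  have "(x powr e) powr (1 / e) \<le> y powr (1 / e)"
    using assms by (intro powr_mono2) auto
  then show ?thesis using assms by (simp add: powr_powr)
qed

lemma lnorm_nonneg [simp]: "0 \<le> lnorm r I f"
  by (simp add: lnorm_def)

lemma lnorm_cong: "(\<And>i. i \<in> I \<Longrightarrow> f i = g i) \<Longrightarrow> lnorm r I f = lnorm r I g"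
  by (simp add: lnorm_def)

lemma lnorm_powr: "r \<noteq> 0 \<Longrightarrow> lnorm r I f powr r = (\<Sum>i\<in>I. f i powr r)"
  by (simp add: lnorm_def powr_powr sum_nonneg)

lemma lnorm_mono:
  assumes "0 < r" "\<And>i. i \<in> I \<Longrightarrow> 0 \<le> f i" "\<And>i. i \<in> I \<Longrightarrow> f i \<le> g i"
  shows "lnorm r I f \<le> lnorm r I g"
  unfolding lnorm_def using assms
  by (intro powr_mono2 sum_nonneg sum_mono) (auto intro: powr_mono2)

lemma lnorm_cmult:
  assumes "0 < r" "0 \<le> c"
  shows "lnorm r I (\<lambda>i. c * f i) = c * lnorm r I f"
  using assms by (simp add: lnorm_def powr_mult sum_distrib_left[symmetric] powr_powr)

lemma lnorm_le_card:
  assumes "finite I" "\<And>i. i \<in> I \<Longrightarrow> 0 \<le> f i" "0 < r" "r \<le> s"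
  shows "lnorm r I f \<le> real (card I) powr (1 / r - 1 / s) * lnorm s I f"
proof -
  have "(\<Sum>i\<in>I. (f i powr s) powr (r / s))
      \<le> real (card I) powr (1 - r / s) * (\<Sum>i\<in>I. f i powr s) powr (r / s)"
    using assms by (intro sum_powr_le_card) auto
  then have "lnorm r I f
      \<le> (real (card I) powr (1 - r / s) * (\<Sum>i\<in>I. f i powr s) powr (r / s)) powr (1 / r)"
    unfolding lnorm_def using assms by (intro powr_mono2) (auto simp: powr_powr intro: sum_nonneg)
  also have "\<dots> = real (card I) powr ((1 - r / s) * (1 / r)) * lnorm s I f"
    using assms by (simp add: lnorm_def powr_mult powr_powr)
  also have "(1 - r / s) * (1 / r) = 1 / r - 1 / s"
    using assms by (simp add: field_simps)
  finally show ?thesis .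
qed

lemma lnorm_antimono:
  assumes "finite I" "\<And>i. i \<in> I \<Longrightarrow> 0 \<le> f i" "0 < r" "r \<le> s"
  shows "lnorm s I f \<le> lnorm r I f"
proof -
  have "(\<Sum>i\<in>I. (f i powr r) powr (s / r)) \<le> (\<Sum>i\<in>I. f i powr r) powr (s / r)"
    using assms by (intro sum_powr_le_powr_sum) auto
  then have "lnorm s I f \<le> ((\<Sum>i\<in>I. f i powr r) powr (s / r)) powr (1 / s)"
    unfolding lnorm_def using assms by (intro powr_mono2) (auto simp: powr_powr intro: sum_nonneg)
  also have "\<dots> = lnorm r I f" using assms by (simp add: lnorm_def powr_powr)
  finally show ?thesis .
qed

text \<open>Log-convexity of the norms in \<open>1 / r\<close>. Two functions are allowed because
  the outer norm of a mixed norm is later interpolated between two different families of inner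
  norms.\<close>

lemma lnorm_interpolate:
  assumes "finite I" and "\<And>i. i \<in> I \<Longrightarrow> 0 \<le> f i" and "\<And>i. i \<in> I \<Longrightarrow> 0 \<le> g i"
    and pos: "0 < r" "0 < s" "0 < t" and \<theta>: "0 \<le> \<theta>" "\<theta> \<le> 1" and r: "1 / r = \<theta> / s + (1 - \<theta>) / t"
  shows "lnorm r I (\<lambda>i. f i powr \<theta> * g i powr (1 - \<theta>)) \<le> lnorm s I f powr \<theta> * lnorm t I g powr (1 - \<theta>)"
proof -
  \<comment> \<open>\<open>\<eta>\<close> is the share of the exponent \<open>s\<close> in Hoelder's
    inequality for \<open>r\<close>-th powers; the relation between \<open>r\<close>,
    \<open>s\<close> and \<open>t\<close> says that the share left for \<open>t\<close> is
    \<open>1 - \<eta>\<close>.\<close>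
  define \<eta> where "\<eta> = \<theta> * r / s"
  have \<eta>': "1 - \<eta> = (1 - \<theta>) * r / t"
  proof -
    have "r * (1 / r) = r * (\<theta> / s + (1 - \<theta>) / t)" using r by simp
    then show ?thesis using pos by (simp add: \<eta>_def algebra_simps)
  qed
  have "0 \<le> 1 - \<eta>" unfolding \<eta>' using pos \<theta> by simp
  then have \<eta>: "0 \<le> \<eta>" "\<eta> \<le> 1" using pos \<theta> by (auto simp: \<eta>_def)
  have "(f i powr \<theta> * g i powr (1 - \<theta>)) powr r = (f i powr s) powr \<eta> * (g i powr t) powr (1 - \<eta>)" for i
    unfolding \<eta>' using pos by (simp add: powr_mult powr_powr \<eta>_def)
  then have "(\<Sum>i\<in>I. (f i powr \<theta> * g i powr (1 - \<theta>)) powr r)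
     \<le> (\<Sum>i\<in>I. f i powr s) powr \<eta> * (\<Sum>i\<in>I. g i powr t) powr (1 - \<eta>)"
    using sum_powr_Hoelder[of I "\<lambda>i. f i powr s" "\<lambda>i. g i powr t" \<eta>] assms(1) \<eta> by simp
  then have "lnorm r I (\<lambda>i. f i powr \<theta> * g i powr (1 - \<theta>))
      \<le> ((\<Sum>i\<in>I. f i powr s) powr \<eta> * (\<Sum>i\<in>I. g i powr t) powr (1 - \<eta>)) powr (1 / r)"
    unfolding lnorm_def using pos by (intro powr_mono2) (auto intro!: sum_nonneg)
  also have "\<dots> = lnorm s I f powr \<theta> * lnorm t I g powr (1 - \<theta>)"
    unfolding \<eta>' using pos by (simp add: powr_mult powr_powr \<eta>_def lnorm_def)
  finally show ?thesis .
qed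

text \<open>Passing to a larger exponent costs nothing, passing to a smaller one costs a power of
  the cardinality; \<open>max 0\<close> treats both cases in each variable. This is how a point of
  the critical segment reaches an arbitrary pair of exponents.\<close>

lemma lnorm_lnorm_le_card:
  assumes fin: "finite I" "finite J" and ne: "I \<noteq> {}" "J \<noteq> {}" and u: "\<And>i j. 0 \<le> u i j"
    and pos: "0 < r\<^sub>1" "0 < r\<^sub>2" "0 < s\<^sub>1" "0 < s\<^sub>2"
  shows "lnorm r\<^sub>2 I (\<lambda>i. lnorm r\<^sub>1 J (u i))
    \<le> real (card J) powr max 0 (1 / r\<^sub>1 - 1 / s\<^sub>1) * real (card I) powr max 0 (1 / r\<^sub>2 - 1 / s\<^sub>2)
      * lnorm s\<^sub>2 I (\<lambda>i. lnorm s\<^sub>1 J (u i))"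
proof -
  have le: "lnorm r A f \<le> real (card A) powr max 0 (1 / r - 1 / s) * lnorm s A f"
    if "finite A" "A \<noteq> {}" "\<And>i. 0 \<le> f i" "0 < r" "0 < s" for r s and A :: "'c set" and f
  proof (cases "r \<le> s")
    case True
    then have "max 0 (1 / r - 1 / s) = 1 / r - 1 / s" using that by (simp add: frac_le)
    then show ?thesis using lnorm_le_card[of A f r s] that True by simp
  next
    case False
    then have "max 0 (1 / r - 1 / s) = 0" using that by (simp add: frac_le)
    then show ?thesis using lnorm_antimono[of A f s r] that False by simp
  qed
  have "lnorm r\<^sub>2 I (\<lambda>i. lnorm r\<^sub>1 J (u i))
      \<le> lnorm r\<^sub>2 I (\<lambda>i. real (card J) powr max 0 (1 / r\<^sub>1 - 1 / s\<^sub>1) * lnorm s\<^sub>1 J (u i))"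
    using assms by (intro lnorm_mono le) auto
  also have "\<dots> = real (card J) powr max 0 (1 / r\<^sub>1 - 1 / s\<^sub>1) * lnorm r\<^sub>2 I (\<lambda>i. lnorm s\<^sub>1 J (u i))"
    using pos by (intro lnorm_cmult) auto
  also have "\<dots> \<le> real (card J) powr max 0 (1 / r\<^sub>1 - 1 / s\<^sub>1) * (real (card I) powr max 0 (1 / r\<^sub>2 - 1 / s\<^sub>2)
      * lnorm s\<^sub>2 I (\<lambda>i. lnorm s\<^sub>1 J (u i)))"
    using assms by (intro mult_left_mono le) auto
  finally show ?thesis by (simp only: mult.assoc)
qed

subsection \<open>Endpoint estimates for mixed norms\<close>

text \<open>
  For \<open>n \<ge> 1\<close>, the unit ball of \<open>\<ell>\<^sub>p\<close> consists of the \<open>x\<close> with \<open>|x\<^sub>i| \<le> w\<^sub>i powr (1/p)\<close> for some weights \<open>w\<close>; this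
  description also covers \<open>p = \<infinity>\<close>.
\<close>

definition weights :: "'i set \<Rightarrow> ('i \<Rightarrow> real) set" where
  "weights I = {w. (\<forall>i. 0 \<le> w i) \<and> sum w I \<le> 1}"

lemma weights_le_1:
  assumes "finite I" "w \<in> weights I" "i \<in> I"
  shows "w i \<le> 1"
  using assms member_le_sum[of i I w] by (force simp: weights_def)

lemma weights_powr_le_1:
  assumes "finite I" "w \<in> weights I" "i \<in> I" "0 \<le> a"
  shows "w i powr a \<le> 1"
  using assms weights_le_1[OF assms(1-3)] by (intro powr_le1) (auto simp: weights_def)

lemma weights_sum_powr_le_card:
  assumes "finite I" "w \<in> weights I" "0 \<le> \<theta>" "\<theta> \<le> 1"
  shows "(\<Sum>i\<in>I. w i powr \<theta>) \<le> real (card I) powr (1 - \<theta>)"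
proof -
  have "(\<Sum>i\<in>I. w i powr \<theta>) \<le> real (card I) powr (1 - \<theta>) * sum w I powr \<theta>"
    using assms by (intro sum_powr_le_card) (auto simp: weights_def)
  also have "\<dots> \<le> real (card I) powr (1 - \<theta>) * 1"
    using assms by (intro mult_left_mono powr_le1) (auto simp: weights_def sum_nonneg)
  finally show ?thesis by simp
qed

text \<open>The geometric mean of \<open>w\<close> and \<open>v\<close> with shares
  \<open>a / (a + b)\<close> and \<open>b / (a + b)\<close> is again a weight by Hoelder, and its
  power \<open>a + b\<close> is the summand. The shares make no sense for \<open>a + b = 0\<close>,
  where all terms are at most 1.\<close>

lemma weights_sum_mult_powr_le_card:
  assumes "finite I" "w \<in> weights I" "v \<in> weights I" "0 \<le> a" "0 \<le> b" "a + b \<le> 1"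
  shows "(\<Sum>i\<in>I. w i powr a * v i powr b) \<le> real (card I) powr (1 - a - b)"
proof (cases "a + b = 0")
  case True
  then have "a = 0" "b = 0" using assms by auto
  have "(\<Sum>i\<in>I. w i powr a * v i powr b) \<le> (\<Sum>i\<in>I. 1)"
    using assms by (intro sum_mono mult_le_one weights_powr_le_1) auto
  then show ?thesis using \<open>a = 0\<close> \<open>b = 0\<close> by (cases "card I = 0") auto
next
  case False
  define \<theta> where "\<theta> = a / (a + b)"
  have e: "\<theta> * (a + b) = a" "(1 - \<theta>) * (a + b) = b"
    using False by (auto simp: \<theta>_def field_simps)
  have \<theta>: "0 \<le> \<theta>" "\<theta> \<le> 1" using assms by (auto simp: \<theta>_def divide_le_eq_1)
  define f where "f i = w i powr \<theta> * v i powr (1 - \<theta>)" for i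
  have "sum f I \<le> sum w I powr \<theta> * sum v I powr (1 - \<theta>)"
    unfolding f_def using assms \<theta> by (intro sum_powr_Hoelder) (auto simp: weights_def)
  also have "\<dots> \<le> 1"
    using assms \<theta> by (intro mult_le_one powr_le1) (auto simp: weights_def sum_nonneg)
  finally have "max 0 \<circ> f \<in> weights I"
    by (simp add: weights_def f_def)
  then have "(\<Sum>i\<in>I. f i powr (a + b)) \<le> real (card I) powr (1 - (a + b))"
    using weights_sum_powr_le_card[of I "max 0 \<circ> f" "a + b"] assms by (simp add: f_def)
  moreover have "f i powr (a + b) = w i powr a * v i powr b" for i
    by (simp add: f_def powr_mult powr_powr e)
  ultimately show ?thesis by (simp add: diff_diff_eq)
qed

text \<open>A single application of Hoelder's inequality, with \<open>w\<close> proportional to \<open>B\<^sub>i powr \<rho>\<close>.\<close>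

lemma lnorm_lnorm_le_endpoint_conj:
  fixes u :: "'i \<Rightarrow> 'j \<Rightarrow> real"
  assumes fin: "finite I" "finite J" and a: "0 \<le> a" "a < 1 / 2" and s: "0 < s" "s \<le> 2"
    and H: "\<And>w. w \<in> weights I \<Longrightarrow>
      (\<Sum>j\<in>J. (\<Sum>i\<in>I. w i powr (2 * a) * u i j powr 2) powr (s / 2)) \<le> K"
  shows "lnorm (1 / (1 / 2 - a)) I (\<lambda>i. lnorm s J (u i)) \<le> K powr (1 / s)"
proof -
  define \<rho> where "\<rho> = 1 / (1 / 2 - a)"
  define B where "B = (\<lambda>i. lnorm s J (u i))"
  define N where "N = (\<Sum>i\<in>I. B i powr \<rho>)"
  have \<rho>: "\<rho> > 0" "\<rho> * (1 / 2 - a) = 1" using a by (auto simp: \<rho>_def)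
  have B0: "0 \<le> B i" for i by (simp add: B_def)
  have Bs: "B i powr s = (\<Sum>j\<in>J. u i j powr s)" for i
    using s by (simp add: B_def lnorm_powr)
  have lhs: "lnorm \<rho> I B = N powr (1 / \<rho>)" by (simp add: lnorm_def N_def)
  show ?thesis
  proof (cases "N = 0")
    case True
    then show ?thesis using lhs by (simp add: B_def \<rho>_def)
  next
    case False
    moreover have "N \<ge> 0" by (simp add: N_def sum_nonneg)
    ultimately have N: "N > 0" by simp
    define w where "w = (\<lambda>i. B i powr \<rho> / N)"
    have w: "w \<in> weights I"
      using N by (auto simp: weights_def w_def sum_divide_distrib[symmetric] N_def)
    define G where "G = (\<lambda>j. \<Sum>i\<in>I. w i powr (2 * a) * u i j powr 2)"
    \<comment> \<open>The factor \<open>N powr (a * s)\<close> undoes the normalisation of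
      \<open>w\<close>, and \<open>\<rho> * (1 / 2 - a) = 1\<close> balances the powers of
      \<open>B i\<close>. In this form each column is ready for Hoelder with shares
      \<open>s / 2\<close> and \<open>1 - s / 2\<close>.\<close>
    have entry: "B i powr (\<rho> - s) * u i j powr s
        = N powr (a * s) * ((w i powr (2 * a) * u i j powr 2) powr (s / 2) * (B i powr \<rho>) powr (1 - s / 2))"
      for i j
    proof -
      have e: "\<rho> * a * s + \<rho> * (1 - s / 2) = \<rho> - s"
      proof -
        have "\<rho> * a * s + \<rho> * (1 - s / 2) = \<rho> - s * (\<rho> * (1 / 2 - a))" by (simp add: algebra_simps)
        then show ?thesis using \<rho>(2) by simp
      qed
      have "(w i powr (2 * a) * u i j powr 2) powr (s / 2) = B i powr (\<rho> * a * s) / N powr (a * s) * u i j powr s"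
        by (simp add: w_def powr_mult powr_divide powr_powr mult.assoc del: powr_numeral)
      then have "N powr (a * s) * ((w i powr (2 * a) * u i j powr 2) powr (s / 2) * (B i powr \<rho>) powr (1 - s / 2))
          = B i powr (\<rho> * a * s) * B i powr (\<rho> * (1 - s / 2)) * u i j powr s"
        using N by (simp add: powr_powr)
      also have "\<dots> = B i powr (\<rho> - s) * u i j powr s"
        by (simp only: powr_add[symmetric] e)
      finally show ?thesis by simp
    qed
    have col: "(\<Sum>i\<in>I. B i powr (\<rho> - s) * u i j powr s)
        \<le> N powr (a * s) * (G j powr (s / 2) * N powr (1 - s / 2))" for j
      unfolding entry sum_distrib_left[symmetric] G_def N_def using s N fin
      by (intro mult_left_mono sum_powr_Hoelder) auto
    have "N = (\<Sum>i\<in>I. B i powr (\<rho> - s) * B i powr s)"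
      by (simp add: N_def powr_add[symmetric])
    also have "\<dots> = (\<Sum>i\<in>I. \<Sum>j\<in>J. B i powr (\<rho> - s) * u i j powr s)"
      unfolding Bs by (simp add: sum_distrib_left)
    also have "\<dots> = (\<Sum>j\<in>J. \<Sum>i\<in>I. B i powr (\<rho> - s) * u i j powr s)" by (rule sum.swap)
    also have "\<dots> \<le> (\<Sum>j\<in>J. N powr (a * s) * (G j powr (s / 2) * N powr (1 - s / 2)))"
      by (rule sum_mono[OF col])
    also have "\<dots> = N powr (a * s) * N powr (1 - s / 2) * (\<Sum>j\<in>J. G j powr (s / 2))"
      by (simp add: sum_distrib_left mult_ac)
    also have "\<dots> \<le> N powr (a * s) * N powr (1 - s / 2) * K"
      using H[OF w] by (intro mult_left_mono) (auto simp: G_def)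
    \<comment> \<open>\<open>N\<close> occurs on both sides; as
      \<open>1 - a * s - (1 - s / 2) = s * (1 / 2 - a)\<close>, cancelling leaves a positive power
      of \<open>N\<close> on the left.\<close>
    finally have "N powr (s * (1 / 2 - a)) * (N powr (a * s) * N powr (1 - s / 2)) \<le> K * (N powr (a * s) * N powr (1 - s / 2))"
      using N by (simp add: powr_add[symmetric] algebra_simps)
    then have "N powr (s * (1 / 2 - a)) \<le> K" using N by simp
    then have "(N powr (1 / 2 - a)) powr s \<le> K" by (simp add: powr_powr mult.commute)
    then have "N powr (1 / 2 - a) \<le> K powr (1 / s)"
      using s by (intro powr_le_imp_le_powr_inverse) auto
    then show ?thesis using lhs by (simp add: B_def \<rho>_def)
  qed
qed

text \<open>
  With \<open>S\<^sub>i = \<Sum>\<^sub>j u\<^sub>i\<^sub>j\<^sup>2\<close>, the sum \<open>\<Sum>\<^sub>i S\<^sub>i powr (\<nu>/2) = \<Sum>\<^sub>j \<Sum>\<^sub>i u\<^sub>i\<^sub>j\<^sup>2 S\<^sub>i powr (\<nu>/2 - 1)\<close> is split by Hoelder's inequality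
  between \<open>U\<^sub>j = \<Sum>\<^sub>i u\<^sub>i\<^sub>j\<^sup>2 S\<^sub>i powr (\<mu>/2 - 1)\<close>, controlled by the second hypothesis, and
  \<open>V\<^sub>j = \<Sum>\<^sub>i u\<^sub>i\<^sub>j\<^sup>2 S\<^sub>i powr (\<nu> a)\<close>, controlled by the first one with \<open>w\<close> proportional to \<open>S\<^sub>i powr (\<nu>/2)\<close>.
\<close>

lemma lnorm_lnorm_le_endpoint_2:
  fixes u :: "'i \<Rightarrow> 'j \<Rightarrow> real"
  assumes fin: "finite I" "finite J" and a: "0 \<le> a" "a < 1 / 2" and b: "0 \<le> b" "b \<le> 1 / 2" and K: "1 \<le> K"
    and H1: "\<And>w. w \<in> weights I \<Longrightarrow>
      (\<Sum>j\<in>J. (\<Sum>i\<in>I. w i powr (2 * a) * u i j powr 2) powr (1 / (1 - b) / 2)) \<le> K"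
    and H2: "\<And>v. v \<in> weights J \<Longrightarrow>
      (\<Sum>i\<in>I. (\<Sum>j\<in>J. v j powr (2 * b) * u i j powr 2) powr (1 / (1 - a) / 2)) \<le> K"
  shows "lnorm (1 / (1 - a - b)) I (\<lambda>i. lnorm 2 J (u i)) \<le> K powr (2 / (1 - 2 * a))"
proof -
  \<comment> \<open>With \<open>a = 1/p\<close> and \<open>b = 1/q\<close>, \<open>s\<close> and
    \<open>\<mu>\<close> are the conjugate exponents of \<open>q\<close> and \<open>p\<close>,
    \<open>\<nu>\<close> is the outer exponent aimed at, and \<open>\<sigma>\<close> is the exponent
    with which the \<open>U j\<close> will be summed.\<close>
  define s \<mu> \<nu> \<sigma> where "s = 1 / (1 - b)" and "\<mu> = 1 / (1 - a)" and "\<nu> = 1 / (1 - a - b)"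
    and "\<sigma> = \<nu> / \<mu>"
  define D where "D = (1 - a) - b * (1 - 2 * a)"
  \<comment> \<open>The share of \<open>V j\<close> in the Hoelder splitting. It is determined by
    \<open>e1\<close>, which matches the powers of \<open>S i\<close>; \<open>e2\<close> then says
    that the shares in the outer sum over \<open>j\<close> match as well.\<close>
  define \<tau> where "\<tau> = b / D"
  have ab: "1 - a - b > 0" "1 - a > 0" "1 - b > 0" using a b by auto
  have bD: "b \<le> D"
  proof -
    have "b * (2 * (1 - a)) \<le> 1 / 2 * (2 * (1 - a))" using a b by (intro mult_right_mono) auto
    then show ?thesis by (simp add: D_def algebra_simps)
  qed
  have D: "D > 0"
  proof -
    have "b * (1 - 2 * a) \<le> 1 / 2 * (1 - 2 * a)" using a b by (intro mult_right_mono) auto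
    then show ?thesis using a by (simp add: D_def algebra_simps)
  qed
  have \<tau>: "0 \<le> \<tau>" "\<tau> \<le> 1" "\<tau> * D = b" using b D bD by (auto simp: \<tau>_def)
  have pos: "s > 0" "\<mu> > 0" "\<nu> > 0" "\<sigma> > 0" using ab by (auto simp: s_def \<mu>_def \<nu>_def \<sigma>_def)
  have e1: "(1 - \<tau>) * (\<mu> / 2 - 1) + \<tau> * (\<nu> * a) = \<nu> / 2 - 1"
  proof -
    have i: "\<nu> * a - \<mu> / 2 + 1 = D * \<mu> * \<nu> / 2"
    proof -
      have D': "D = 2 * (1 - a) * (1 - a - b) - (1 - a - b) + 2 * a * (1 - a)"
        by (simp add: D_def algebra_simps)
      have "D * \<mu> * \<nu> / 2 = ((1 - a) * \<mu>) * ((1 - a - b) * \<nu>) - ((1 - a - b) * \<nu>) * \<mu> / 2 + a * ((1 - a) * \<mu>) * \<nu>"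
        unfolding D' by (simp add: field_simps)
      also have "(1 - a) * \<mu> = 1" using ab by (simp add: \<mu>_def)
      also have "(1 - a - b) * \<nu> = 1" using ab by (simp add: \<nu>_def)
      finally show ?thesis by simp
    qed
    have ii: "\<nu> / 2 - \<mu> / 2 = b * \<mu> * \<nu> / 2"
    proof -
      have "b * \<mu> * \<nu> / 2 = ((1 - a) * \<mu>) * \<nu> / 2 - ((1 - a - b) * \<nu>) * \<mu> / 2"
        by (simp add: field_simps)
      also have "(1 - a) * \<mu> = 1" using ab by (simp add: \<mu>_def)
      also have "(1 - a - b) * \<nu> = 1" using ab by (simp add: \<nu>_def)
      finally show ?thesis by simp
    qed
    have "(1 - \<tau>) * (\<mu> / 2 - 1) + \<tau> * (\<nu> * a) = \<mu> / 2 - 1 + \<tau> * (\<nu> * a - \<mu> / 2 + 1)"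
      by (simp add: field_simps)
    also have "\<dots> = \<mu> / 2 - 1 + (\<tau> * D) * \<mu> * \<nu> / 2" unfolding i by simp
    also have "\<dots> = \<nu> / 2 - 1" unfolding \<tau>(3) using ii by linarith
    finally show ?thesis .
  qed
  have e2: "1 - (1 - \<tau>) / \<sigma> = \<tau> * 2 / s"
  proof -
    have i: "1 / \<sigma> = (1 - a - b) / (1 - a)" "1 / s = 1 - b"
      using ab by (auto simp: \<sigma>_def \<nu>_def \<mu>_def s_def)
    have "(1 - a) * (1 - (1 - \<tau>) * ((1 - a - b) / (1 - a))) = b + \<tau> * (1 - a - b)"
      using ab by (simp add: field_simps)
    also have "\<dots> = \<tau> * D + \<tau> * (1 - a - b)" using \<tau>(3) by simp
    also have "\<dots> = (1 - a) * (\<tau> * 2 * (1 - b))" by (simp add: D_def algebra_simps)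
    finally have "1 - (1 - \<tau>) * ((1 - a - b) / (1 - a)) = \<tau> * 2 * (1 - b)"
      using ab by simp
    then show ?thesis unfolding i[symmetric] by simp
  qed
  have e3: "1 - b * \<mu> = 1 / \<sigma>"
  proof -
    have "1 / \<sigma> = (1 - a - b) / (1 - a)" by (simp add: \<sigma>_def \<nu>_def \<mu>_def)
    then show ?thesis using ab by (simp add: \<mu>_def diff_divide_distrib)
  qed
  have e4: "\<sigma> * (b * \<mu>) + 1 = \<sigma>"
  proof -
    have "\<sigma> * (1 - b * \<mu>) = 1" unfolding e3 using pos by simp
    then show ?thesis by (simp add: algebra_simps)
  qed
  have \<mu>2: "\<mu> / 2 \<le> 1" using a by (simp add: \<mu>_def field_simps)
  have \<theta>\<sigma>: "(1 - \<tau>) / \<sigma> \<le> 1" "0 \<le> (1 - \<tau>) / \<sigma>"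
    using e2 \<tau> pos by (smt (verit) divide_nonneg_pos mult_nonneg_nonneg)+

  define S where "S = (\<lambda>i. \<Sum>j\<in>J. u i j powr 2)"
  define F where "F = (\<Sum>i\<in>I. S i powr (\<nu> / 2))"
  have S0: "0 \<le> S i" for i by (simp add: S_def sum_nonneg)
  have lhs: "lnorm \<nu> I (\<lambda>i. lnorm 2 J (u i)) = F powr (1 / \<nu>)"
    by (simp add: lnorm_def F_def S_def powr_powr sum_nonneg del: powr_numeral)
  show ?thesis
  proof (cases "F = 0")
    case True
    then show ?thesis using lhs by (simp add: \<nu>_def)
  next
    case False
    moreover have "F \<ge> 0" by (simp add: F_def sum_nonneg)
    ultimately have F: "F > 0" by simp

    define V where "V = (\<lambda>j. \<Sum>i\<in>I. u i j powr 2 * S i powr (\<nu> * a))"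
    have V: "(\<Sum>j\<in>J. V j powr (s / 2)) \<le> K * F powr (a * s)"
    proof -
      define w where "w = (\<lambda>i. S i powr (\<nu> / 2) / F)"
      have w: "w \<in> weights I"
        using F by (auto simp: weights_def w_def sum_divide_distrib[symmetric] F_def)
      have "(\<Sum>i\<in>I. w i powr (2 * a) * u i j powr 2) = V j / F powr (2 * a)" for j
        by (simp add: V_def w_def powr_divide powr_powr sum_divide_distrib mult_ac del: powr_numeral)
      moreover have "(F powr (2 * a)) powr (s / 2) = F powr (a * s)" by (simp add: powr_powr)
      ultimately have "(\<Sum>j\<in>J. V j powr (s / 2)) / F powr (a * s) \<le> K"
        using H1[OF w, folded s_def] by (simp only: powr_divide sum_divide_distrib)
      then show ?thesis using F by (simp add: field_simps)
    qed

    define U where "U = (\<lambda>j. \<Sum>i\<in>I. u i j powr 2 * S i powr (\<mu> / 2 - 1))"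
    define W where "W = (\<Sum>j\<in>J. U j powr \<sigma>)"
    have U0: "0 \<le> U j" for j by (simp add: U_def sum_nonneg)
    have W0: "0 \<le> W" by (simp add: W_def sum_nonneg)
    have W: "W \<le> K powr \<sigma>"
    proof (cases "W = 0")
      case False
      then have W1: "W > 0" using W0 by simp
      \<comment> \<open>The extremal weight for duality: by \<open>e4\<close>, pairing
        \<open>U j\<close> with \<open>v j powr (b * \<mu>)\<close> gives back the sum
        \<open>W\<close> up to normalisation.\<close>
      define v where "v = (\<lambda>j. U j powr \<sigma> / W)"
      have v: "v \<in> weights J"
        using W1 by (auto simp: weights_def v_def sum_divide_distrib[symmetric] W_def)
      \<comment> \<open>Jensen with the weights \<open>u i j powr 2\<close>, whose total is
        \<open>S i\<close>, pulls the power \<open>\<mu> / 2 \<le> 1\<close> out of the sum; the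
        resulting \<open>S i powr (1 - \<mu> / 2)\<close> cancels the factor in front.\<close>
      have row: "S i powr (\<mu> / 2 - 1) * (\<Sum>j\<in>J. u i j powr 2 * v j powr (b * \<mu>))
          \<le> (\<Sum>j\<in>J. v j powr (2 * b) * u i j powr 2) powr (\<mu> / 2)" for i
      proof -
        have "(\<Sum>j\<in>J. u i j powr 2 * (v j powr (2 * b)) powr (\<mu> / 2))
            \<le> (\<Sum>j\<in>J. u i j powr 2 * v j powr (2 * b)) powr (\<mu> / 2) * (\<Sum>j\<in>J. u i j powr 2) powr (1 - \<mu> / 2)"
          using pos \<mu>2 fin by (intro sum_mult_powr_Jensen) auto
        then have "(\<Sum>j\<in>J. u i j powr 2 * v j powr (b * \<mu>))
            \<le> (\<Sum>j\<in>J. v j powr (2 * b) * u i j powr 2) powr (\<mu> / 2) * S i powr (1 - \<mu> / 2)"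
          by (simp add: powr_powr S_def mult.commute del: powr_numeral)
        then have "S i powr (\<mu> / 2 - 1) * (\<Sum>j\<in>J. u i j powr 2 * v j powr (b * \<mu>))
            \<le> S i powr (\<mu> / 2 - 1) * ((\<Sum>j\<in>J. v j powr (2 * b) * u i j powr 2) powr (\<mu> / 2) * S i powr (1 - \<mu> / 2))"
          by (intro mult_left_mono) auto
        also have "\<dots> = (\<Sum>j\<in>J. v j powr (2 * b) * u i j powr 2) powr (\<mu> / 2) * S i powr ((\<mu> / 2 - 1) + (1 - \<mu> / 2))"
          unfolding powr_add by (simp add: mult_ac del: powr_numeral)
        \<comment> \<open>Only an inequality, since \<open>S i powr 0\<close> is 0 rather than 1
          when \<open>S i = 0\<close>.\<close>
        also have "\<dots> \<le> (\<Sum>j\<in>J. v j powr (2 * b) * u i j powr 2) powr (\<mu> / 2)"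
          by simp
        finally show ?thesis .
      qed
      have "W powr (1 - b * \<mu>) = W / W powr (b * \<mu>)" using W1 by (simp add: powr_diff)
      also have "\<dots> = (\<Sum>j\<in>J. U j * U j powr (\<sigma> * (b * \<mu>))) / W powr (b * \<mu>)"
      proof -
        have "U j * U j powr (\<sigma> * (b * \<mu>)) = U j powr \<sigma>" for j
          using U0 e4 by (simp add: powr_mult_base add.commute)
        then show ?thesis by (simp add: W_def)
      qed
      also have "\<dots> = (\<Sum>j\<in>J. U j * v j powr (b * \<mu>))"
        by (simp add: v_def powr_divide powr_powr sum_divide_distrib)
      also have "\<dots> = (\<Sum>i\<in>I. S i powr (\<mu> / 2 - 1) * (\<Sum>j\<in>J. u i j powr 2 * v j powr (b * \<mu>)))"
        unfolding U_def sum_distrib_left sum_distrib_right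
        by (subst sum.swap) (simp add: mult_ac del: powr_numeral)
      also have "\<dots> \<le> (\<Sum>i\<in>I. (\<Sum>j\<in>J. v j powr (2 * b) * u i j powr 2) powr (\<mu> / 2))"
        by (rule sum_mono[OF row])
      also have "\<dots> \<le> K" using H2[OF v] by (simp add: \<mu>_def)
      finally have "W powr (1 / \<sigma>) \<le> K" using e3 by simp
      then have "W \<le> K powr (1 / (1 / \<sigma>))"
        using pos W0 by (intro powr_le_imp_le_powr_inverse) auto
      then show ?thesis by simp
    qed auto

    have col: "(\<Sum>i\<in>I. u i j powr 2 * S i powr (\<nu> / 2 - 1)) \<le> U j powr (1 - \<tau>) * V j powr \<tau>" for j
    proof -
      have "u i j powr 2 * S i powr (\<nu> / 2 - 1)
          = (u i j powr 2 * S i powr (\<mu> / 2 - 1)) powr (1 - \<tau>) * (u i j powr 2 * S i powr (\<nu> * a)) powr (1 - (1 - \<tau>))" for i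
      proof -
        have "(u i j powr 2 * S i powr (\<mu> / 2 - 1)) powr (1 - \<tau>) * (u i j powr 2 * S i powr (\<nu> * a)) powr (1 - (1 - \<tau>))
           = (u i j powr (2 * (1 - \<tau>)) * u i j powr (2 * \<tau>)) * (S i powr ((1 - \<tau>) * (\<mu> / 2 - 1)) * S i powr (\<tau> * (\<nu> * a)))"
          by (simp add: powr_mult powr_powr mult_ac del: powr_numeral)
        also have "\<dots> = u i j powr (2 * (1 - \<tau>) + 2 * \<tau>) * S i powr ((1 - \<tau>) * (\<mu> / 2 - 1) + \<tau> * (\<nu> * a))"
          by (simp only: powr_add)
        also have "2 * (1 - \<tau>) + 2 * \<tau> = 2" by simp
        finally show ?thesis unfolding e1 by simp
      qed
      then have "(\<Sum>i\<in>I. u i j powr 2 * S i powr (\<nu> / 2 - 1)) \<le> U j powr (1 - \<tau>) * V j powr (1 - (1 - \<tau>))"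
        unfolding U_def V_def using \<tau> fin
        by (simp only:) (intro sum_powr_Hoelder, auto)
      then show ?thesis by simp
    qed
    have "F = (\<Sum>i\<in>I. S i * S i powr (\<nu> / 2 - 1))"
      using S0 by (simp add: F_def powr_mult_base)
    also have "\<dots> = (\<Sum>j\<in>J. \<Sum>i\<in>I. u i j powr 2 * S i powr (\<nu> / 2 - 1))"
    proof -
      have "S i * S i powr (\<nu> / 2 - 1) = (\<Sum>j\<in>J. u i j powr 2 * S i powr (\<nu> / 2 - 1))" for i
        by (simp add: S_def sum_distrib_right del: powr_numeral)
      then show ?thesis by (simp add: sum.swap[of _ J] del: powr_numeral)
    qed
    also have "\<dots> \<le> (\<Sum>j\<in>J. U j powr (1 - \<tau>) * V j powr \<tau>)" by (rule sum_mono[OF col])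
    also have "\<dots> = (\<Sum>j\<in>J. (U j powr \<sigma>) powr ((1 - \<tau>) / \<sigma>) * (V j powr (s / 2)) powr (1 - (1 - \<tau>) / \<sigma>))"
      unfolding e2 using pos by (simp add: powr_powr)
    also have "\<dots> \<le> W powr ((1 - \<tau>) / \<sigma>) * (\<Sum>j\<in>J. V j powr (s / 2)) powr (1 - (1 - \<tau>) / \<sigma>)"
      unfolding W_def using fin \<theta>\<sigma> by (intro sum_powr_Hoelder) auto
    also have "\<dots> \<le> (K powr \<sigma>) powr ((1 - \<tau>) / \<sigma>) * (K * F powr (a * s)) powr (1 - (1 - \<tau>) / \<sigma>)"
      using W V W0 \<theta>\<sigma> by (intro mult_mono powr_mono2) (auto intro: sum_nonneg)
    also have "\<dots> = K powr ((1 - \<tau>) + \<tau> * 2 / s) * F powr (2 * a * \<tau>)"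
      unfolding e2 using pos by (simp add: powr_powr powr_mult powr_add mult_ac)
    \<comment> \<open>\<open>V\<close> was bounded in terms of \<open>F\<close> itself; that power
      of \<open>F\<close> is absorbed on the left, where the exponent stays positive because
      \<open>2 * a < 1\<close> and \<open>\<tau> \<le> 1\<close>.\<close>
    finally have "F powr (1 - 2 * a * \<tau>) \<le> K powr ((1 - \<tau>) + \<tau> * 2 / s)"
      using F by (simp add: powr_diff field_simps)
    moreover have d: "1 - 2 * a \<le> 1 - 2 * a * \<tau>"
      using mult_left_mono[OF \<tau>(2), of "2 * a"] a by simp
    ultimately have "F \<le> (K powr ((1 - \<tau>) + \<tau> * 2 / s)) powr (1 / (1 - 2 * a * \<tau>))"
      using a F by (intro powr_le_imp_le_powr_inverse) auto
    also have "\<dots> = K powr (((1 - \<tau>) + \<tau> * 2 / s) / (1 - 2 * a * \<tau>))" by (simp add: powr_powr)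
    \<comment> \<open>As \<open>K \<ge> 1\<close>, the exponent may be enlarged to one that depends
      on \<open>a\<close> only.\<close>
    also have "\<dots> \<le> K powr (2 / (1 - 2 * a))"
    proof (intro powr_mono frac_le K)
      have "\<tau> * 2 * (1 - b) \<le> \<tau> * 2 * 1" using \<tau> b by (intro mult_left_mono) auto
      then show "(1 - \<tau>) + \<tau> * 2 / s \<le> 2" using \<tau> by (simp add: s_def)
    qed (use a d in auto)
    finally have FK: "F \<le> K powr (2 / (1 - 2 * a))" .
    have "F powr (1 / \<nu>) \<le> (K powr (2 / (1 - 2 * a))) powr (1 / \<nu>)"
      using FK F pos by (intro powr_mono2) auto
    also have "\<dots> \<le> (K powr (2 / (1 - 2 * a))) powr 1"
    proof (rule powr_mono)
      show "1 / \<nu> \<le> 1" using a b by (simp add: \<nu>_def)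
      show "1 \<le> K powr (2 / (1 - 2 * a))" using K a by (intro ge_one_powr_ge_zero) auto
    qed
    finally show ?thesis using lhs by (simp add: \<nu>_def)
  qed
qed

subsection \<open>Khinchine's inequality\<close>

text \<open>A subset encodes a pattern of signs, so that sums over \<open>Pow I\<close> play the
  role of expectations over independent random signs.\<close>

definition sign_on :: "'i set \<Rightarrow> 'i \<Rightarrow> real" where
  "sign_on A i = (if i \<in> A then - 1 else 1)"

lemma sum_Pow_insert:
  fixes g :: "'i set \<Rightarrow> 'b::comm_monoid_add"
  assumes "finite F" "x \<notin> F"
  shows "(\<Sum>A\<in>Pow (insert x F). g A) = (\<Sum>A\<in>Pow F. g A + g (insert x A))"
proof -
  have "(\<Sum>A\<in>Pow (insert x F). g A) = (\<Sum>A\<in>Pow F. g A) + (\<Sum>A\<in>insert x ` Pow F. g A)"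
    unfolding Pow_insert using assms by (intro sum.union_disjoint) auto
  also have "(\<Sum>A\<in>insert x ` Pow F. g A) = (\<Sum>A\<in>Pow F. g (insert x A))"
    using assms by (intro sum.reindex_cong[of "insert x"] inj_onI) (auto simp: insert_ident)
  finally show ?thesis by (simp add: sum.distrib)
qed

lemma sum_sign_on_insert:
  fixes c :: "'i \<Rightarrow> 'k::real_vector"
  assumes "finite F" "x \<notin> F" "A \<subseteq> F"
  shows "(\<Sum>i\<in>insert x F. sign_on A i *\<^sub>R c i) = (\<Sum>i\<in>F. sign_on A i *\<^sub>R c i) + c x"
    and "(\<Sum>i\<in>insert x F. sign_on (insert x A) i *\<^sub>R c i) = (\<Sum>i\<in>F. sign_on A i *\<^sub>R c i) - c x"
proof -
  have "(\<Sum>i\<in>F. sign_on (insert x A) i *\<^sub>R c i) = (\<Sum>i\<in>F. sign_on A i *\<^sub>R c i)"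
    using assms by (intro sum.cong) (auto simp: sign_on_def)
  then show "(\<Sum>i\<in>insert x F. sign_on (insert x A) i *\<^sub>R c i) = (\<Sum>i\<in>F. sign_on A i *\<^sub>R c i) - c x"
    using assms by (simp add: sign_on_def)
  show "(\<Sum>i\<in>insert x F. sign_on A i *\<^sub>R c i) = (\<Sum>i\<in>F. sign_on A i *\<^sub>R c i) + c x"
    using assms by (auto simp: sign_on_def)
qed

lemma norm_add_diff_square:
  fixes x y :: "'k::real_inner"
  shows "(norm (x + y))\<^sup>2 + (norm (x - y))\<^sup>2 = 2 * ((norm x)\<^sup>2 + (norm y)\<^sup>2)"
  by (simp add: power2_norm_eq_inner inner_add_left inner_add_right inner_diff_left inner_diff_right)

text \<open>The two squared norms are \<open>p + d\<close> and \<open>p - d\<close>, so only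
  \<open>d\<^sup>2\<close> survives as a cross term, and Cauchy-Schwarz bounds it. The coefficient 6
  is 2 from \<open>p\<^sup>2\<close> plus 4 from \<open>d\<^sup>2\<close>.\<close>

lemma norm_add_diff_power4:
  fixes x y :: "'k::real_inner"
  shows "norm (x + y) ^ 4 + norm (x - y) ^ 4
    \<le> 2 * (norm x ^ 4 + 6 * (norm x)\<^sup>2 * (norm y)\<^sup>2 + norm y ^ 4)"
proof -
  define p d where "p = (norm x)\<^sup>2 + (norm y)\<^sup>2" and "d = 2 * (x \<bullet> y)"
  have "(norm (x + y))\<^sup>2 = p + d" "(norm (x - y))\<^sup>2 = p - d"
    by (simp_all add: p_def d_def power2_norm_eq_inner inner_add_left inner_add_right
        inner_diff_left inner_diff_right inner_commute)
  moreover have "norm z ^ 4 = ((norm z)\<^sup>2)\<^sup>2" for z :: 'k by simp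
  ultimately have "norm (x + y) ^ 4 + norm (x - y) ^ 4 = (p + d)\<^sup>2 + (p - d)\<^sup>2"
    by (simp only:)
  also have "\<dots> = 2 * p\<^sup>2 + 2 * d\<^sup>2" by (simp add: power2_eq_square algebra_simps)
  finally have "norm (x + y) ^ 4 + norm (x - y) ^ 4 = 2 * p\<^sup>2 + 2 * d\<^sup>2" .
  moreover have "d\<^sup>2 \<le> 4 * ((norm x)\<^sup>2 * (norm y)\<^sup>2)"
    using Cauchy_Schwarz_ineq[of x y] by (simp add: d_def power_mult_distrib power2_norm_eq_inner)
  ultimately show ?thesis by (simp add: p_def power2_sum power_mult_distrib)
qed

text \<open>Induction on the index set: the two signs of a new index are paired, and the
  parallelogram law removes the cross terms.\<close>

lemma sum_sign_on_square:
  fixes c :: "'i \<Rightarrow> 'k::real_inner"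
  assumes "finite I"
  shows "(\<Sum>A\<in>Pow I. (norm (\<Sum>i\<in>I. sign_on A i *\<^sub>R c i))\<^sup>2) = 2 ^ card I * (\<Sum>i\<in>I. (norm (c i))\<^sup>2)"
  using assms
proof (induction I)
  case (insert x F)
  have "(\<Sum>A\<in>Pow (insert x F). (norm (\<Sum>i\<in>insert x F. sign_on A i *\<^sub>R c i))\<^sup>2)
     = (\<Sum>A\<in>Pow F. 2 * ((norm (\<Sum>i\<in>F. sign_on A i *\<^sub>R c i))\<^sup>2 + (norm (c x))\<^sup>2))"
    unfolding sum_Pow_insert[OF insert.hyps]
    by (intro sum.cong) (simp_all only: Pow_iff sum_sign_on_insert[OF insert.hyps] norm_add_diff_square)
  also have "\<dots> = 2 * (2 ^ card F * (\<Sum>i\<in>F. (norm (c i))\<^sup>2)) + 2 * (2 ^ card F * (norm (c x))\<^sup>2)"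
    using insert by (simp add: sum_distrib_left[symmetric] sum.distrib card_Pow)
  finally show ?case using insert.hyps by (simp add: algebra_simps)
qed auto

text \<open>In the induction the cross term with coefficient 6 is exactly the one in
  \<open>3 * (S + (norm (c x))\<^sup>2)\<^sup>2\<close>, which explains the constant 3; the new
  fourth power is overestimated by the factor 3.\<close>

lemma sum_sign_on_power4:
  fixes c :: "'i \<Rightarrow> 'k::real_inner"
  assumes "finite I"
  shows "(\<Sum>A\<in>Pow I. norm (\<Sum>i\<in>I. sign_on A i *\<^sub>R c i) ^ 4) \<le> 3 * 2 ^ card I * (\<Sum>i\<in>I. (norm (c i))\<^sup>2)\<^sup>2"
  using assms
proof (induction I)
  case (insert x F)
  define S where "S = (\<Sum>i\<in>F. (norm (c i))\<^sup>2)"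
  define X where "X A = (\<Sum>i\<in>F. sign_on A i *\<^sub>R c i)" for A
  have "(\<Sum>A\<in>Pow (insert x F). norm (\<Sum>i\<in>insert x F. sign_on A i *\<^sub>R c i) ^ 4)
     = (\<Sum>A\<in>Pow F. norm (X A + c x) ^ 4 + norm (X A - c x) ^ 4)"
    unfolding sum_Pow_insert[OF insert.hyps] X_def
    by (intro sum.cong) (simp_all only: Pow_iff sum_sign_on_insert[OF insert.hyps])
  also have "\<dots> \<le> (\<Sum>A\<in>Pow F. 2 * (norm (X A) ^ 4 + 6 * (norm (X A))\<^sup>2 * (norm (c x))\<^sup>2 + norm (c x) ^ 4))"
    by (intro sum_mono norm_add_diff_power4)
  also have "\<dots> = 2 * ((\<Sum>A\<in>Pow F. norm (X A) ^ 4) + 6 * (\<Sum>A\<in>Pow F. (norm (X A))\<^sup>2) * (norm (c x))\<^sup>2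
      + 2 ^ card F * norm (c x) ^ 4)"
    using insert.hyps by (simp add: sum_distrib_left[symmetric] sum_distrib_right[symmetric] sum.distrib card_Pow)
  also have "\<dots> \<le> 2 * (3 * 2 ^ card F * S\<^sup>2 + 6 * (2 ^ card F * S) * (norm (c x))\<^sup>2 + 2 ^ card F * norm (c x) ^ 4)"
    using insert.IH sum_sign_on_square[OF insert.hyps(1), of c] by (simp add: X_def S_def)
  also have "\<dots> \<le> 2 * (3 * 2 ^ card F * S\<^sup>2 + 6 * (2 ^ card F * S) * (norm (c x))\<^sup>2 + 3 * (2 ^ card F * norm (c x) ^ 4))"
    by simp
  also have "\<dots> = 3 * 2 ^ Suc (card F) * (S + (norm (c x))\<^sup>2)\<^sup>2"
    by (simp add: power2_eq_square power4_eq_xxxx algebra_simps)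
  finally show ?case using insert.hyps by (simp add: S_def add.commute)
qed auto

text \<open>A minorant of \<open>t powr s\<close> built from even powers reduces Khinchine's
  inequality to second and fourth moments. For \<open>t > 1\<close> the left side is at most
  \<open>3 / 2\<close>, by completing the square in \<open>t\<^sup>2\<close>.\<close>

lemma powr_ge_quartic:
  fixes t s :: real
  assumes "0 \<le> t" "1 \<le> s" "s \<le> 2"
  shows "t\<^sup>2 - t ^ 4 / 6 \<le> 6 * t powr s"
proof (cases "t \<le> 1")
  case True
  have "t\<^sup>2 = t powr 2" using assms by simp
  also have "\<dots> \<le> t powr s" using True assms by (intro powr_mono') auto
  also have "\<dots> \<le> 6 * t powr s" by simp
  finally have "t\<^sup>2 \<le> 6 * t powr s" .
  moreover have "0 \<le> t ^ 4" by simp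
  ultimately show ?thesis by linarith
next
  case False
  have "t ^ 4 = t\<^sup>2 * t\<^sup>2" by (simp add: power2_eq_square power4_eq_xxxx)
  then have "t\<^sup>2 - t ^ 4 / 6 = 3 / 2 - (t\<^sup>2 - 3)\<^sup>2 / 6" by (simp add: power2_eq_square field_simps)
  moreover have "1 \<le> t powr s" using False assms by (intro ge_one_powr_ge_zero) auto
  moreover have "0 \<le> (t\<^sup>2 - 3)\<^sup>2" by simp
  ultimately show ?thesis by linarith
qed

text \<open>After normalising by the root of the second moment, the mean of the quartic minorant is
  at least \<open>1 - 3 / 6 = 1 / 2\<close>. Together with the factor 6 of the minorant this gives
  the constant 12.\<close>

lemma Khinchine_sum:
  fixes c :: "'i \<Rightarrow> 'k::real_inner"
  assumes "finite I" "1 \<le> s" "s \<le> 2"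
  shows "2 ^ card I * (\<Sum>i\<in>I. (norm (c i))\<^sup>2) powr (s / 2)
    \<le> 12 * (\<Sum>A\<in>Pow I. norm (\<Sum>i\<in>I. sign_on A i *\<^sub>R c i) powr s)"
proof (cases "(\<Sum>i\<in>I. (norm (c i))\<^sup>2) = 0")
  case True
  then show ?thesis by (simp add: sum_nonneg)
next
  case False
  define S where "S = (\<Sum>i\<in>I. (norm (c i))\<^sup>2)"
  define \<sigma> where "\<sigma> = sqrt S"
  define X where "X A = norm (\<Sum>i\<in>I. sign_on A i *\<^sub>R c i)" for A
  have "S \<ge> 0" by (simp add: S_def sum_nonneg)
  then have S: "S > 0" using False S_def by simp
  then have \<sigma>: "\<sigma> > 0" "\<sigma>\<^sup>2 = S" by (auto simp: \<sigma>_def)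
  have "\<sigma> ^ 4 = (\<sigma>\<^sup>2)\<^sup>2" by simp
  moreover have "\<sigma> powr s = S powr (s / 2)"
    using S by (simp add: \<sigma>_def powr_half_sqrt[symmetric] powr_powr)
  ultimately have \<sigma>: "\<sigma> > 0" "\<sigma>\<^sup>2 = S" "\<sigma> ^ 4 = S\<^sup>2" "\<sigma> powr s = S powr (s / 2)"
    using \<sigma> by auto
  have "2 ^ card I / 2 \<le> 2 ^ card I * S / S - 3 * 2 ^ card I * S\<^sup>2 / (6 * S\<^sup>2)"
    using S by (simp add: field_simps)
  also have "\<dots> \<le> (\<Sum>A\<in>Pow I. (X A)\<^sup>2) / S - (\<Sum>A\<in>Pow I. X A ^ 4) / (6 * S\<^sup>2)"
    using sum_sign_on_square[OF assms(1), of c] sum_sign_on_power4[OF assms(1), of c] S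
    by (intro diff_mono divide_right_mono) (auto simp: X_def S_def)
  also have "\<dots> = (\<Sum>A\<in>Pow I. (X A / \<sigma>)\<^sup>2 - (X A / \<sigma>) ^ 4 / 6)"
    by (simp add: \<sigma> power_divide sum_subtractf sum_divide_distrib mult.commute)
  also have "\<dots> \<le> (\<Sum>A\<in>Pow I. 6 * (X A / \<sigma>) powr s)"
    using \<sigma> assms by (intro sum_mono powr_ge_quartic) (auto simp: X_def)
  also have "\<dots> = 6 * (\<Sum>A\<in>Pow I. X A powr s) / S powr (s / 2)"
    by (simp add: powr_divide \<sigma> sum_divide_distrib sum_distrib_left)
  finally show ?thesis using S by (simp add: X_def S_def field_simps)
qed

text \<open>Khinchine is summed over all columns before a pattern is chosen: some pattern reaches
  the average of the total, so one choice of signs serves every \<open>j\<close> at once.\<close>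

lemma exists_signs_Khinchine:
  fixes c :: "'i \<Rightarrow> 'j \<Rightarrow> 'k::real_inner"
  assumes "finite I" "1 \<le> s" "s \<le> 2"
  obtains \<epsilon> :: "'i \<Rightarrow> real" where "\<And>i. \<bar>\<epsilon> i\<bar> = 1"
    and "(\<Sum>j\<in>J. (\<Sum>i\<in>I. (norm (c i j))\<^sup>2) powr (s / 2)) \<le> 12 * (\<Sum>j\<in>J. norm (\<Sum>i\<in>I. \<epsilon> i *\<^sub>R c i j) powr s)"
proof -
  define L where "L = (\<Sum>j\<in>J. (\<Sum>i\<in>I. (norm (c i j))\<^sup>2) powr (s / 2))"
  define R where "R A = 12 * (\<Sum>j\<in>J. norm (\<Sum>i\<in>I. sign_on A i *\<^sub>R c i j) powr s)" for A
  have "(\<Sum>A\<in>Pow I. L) = (\<Sum>j\<in>J. 2 ^ card I * (\<Sum>i\<in>I. (norm (c i j))\<^sup>2) powr (s / 2))"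
    using assms by (simp add: L_def card_Pow sum_distrib_left)
  also have "\<dots> \<le> (\<Sum>j\<in>J. 12 * (\<Sum>A\<in>Pow I. norm (\<Sum>i\<in>I. sign_on A i *\<^sub>R c i j) powr s))"
    by (intro sum_mono Khinchine_sum assms)
  also have "\<dots> = (\<Sum>A\<in>Pow I. R A)"
    by (simp add: R_def sum_distrib_left sum.swap[of _ J])
  finally have "\<exists>A\<in>Pow I. L \<le> R A"
    using assms(1) by (meson finite_Pow_iff Pow_not_empty not_le sum_strict_mono)
  then obtain A where "L \<le> R A" by blast
  moreover have "\<bar>sign_on A i\<bar> = 1" for i by (simp add: sign_on_def)
  ultimately show thesis using that[of "sign_on A"] by (simp add: L_def R_def)
qed

text \<open>For \<open>a = 1/p\<close> and \<open>b = 1/q\<close> this says that the form with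
  coefficient matrix \<open>c\<close> has norm at most \<open>K\<close>. Stating it through weights
  makes infinite exponents the case \<open>a = 0\<close> or \<open>b = 0\<close>.\<close>

definition bounded_on_weights ::
    "'i set \<Rightarrow> 'j set \<Rightarrow> real \<Rightarrow> real \<Rightarrow> ('i \<Rightarrow> 'j \<Rightarrow> 'k::real_normed_field) \<Rightarrow> real \<Rightarrow> bool" where
  "bounded_on_weights I J a b c K \<longleftrightarrow>
     (\<forall>w\<in>weights I. \<forall>v\<in>weights J. \<forall>x y.
        (\<forall>i\<in>I. norm (x i) \<le> w i powr a) \<longrightarrow> (\<forall>j\<in>J. norm (y j) \<le> v j powr b) \<longrightarrow>
        norm (\<Sum>i\<in>I. \<Sum>j\<in>J. x i * y j * c i j) \<le> K)"

lemma bounded_on_weights_transpose: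
  fixes c :: "'i \<Rightarrow> 'j \<Rightarrow> 'k::real_normed_field"
  assumes "bounded_on_weights I J a b c K"
  shows "bounded_on_weights J I b a (\<lambda>j i. c i j) K"
  unfolding bounded_on_weights_def
proof (intro ballI allI impI)
  fix w v and x :: "'j \<Rightarrow> 'k" and y :: "'i \<Rightarrow> 'k"
  assume *: "w \<in> weights J" "v \<in> weights I" "\<forall>i\<in>J. norm (x i) \<le> w i powr b" "\<forall>j\<in>I. norm (y j) \<le> v j powr a"
  have "(\<Sum>i\<in>J. \<Sum>j\<in>I. x i * y j * c j i) = (\<Sum>i\<in>I. \<Sum>j\<in>J. y i * x j * c i j)"
    by (subst sum.swap) (simp add: mult.commute)
  then show "norm (\<Sum>i\<in>J. \<Sum>j\<in>I. x i * y j * c j i) \<le> K"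
    using assms * by (simp add: bounded_on_weights_def)
qed

text \<open>The converse of Hoelder's inequality: the functional is tested on the vector for which
  Hoelder is an equality.\<close>

lemma sum_norm_powr_le_1_if_dual:
  fixes z :: "'j \<Rightarrow> 'k::real_normed_field"
  assumes "finite J" and b: "0 \<le> b" "b < 1"
    and bound: "\<And>v y. v \<in> weights J \<Longrightarrow> \<forall>j\<in>J. norm (y j) \<le> v j powr b \<Longrightarrow> norm (\<Sum>j\<in>J. y j * z j) \<le> 1"
  shows "(\<Sum>j\<in>J. norm (z j) powr (1 / (1 - b))) \<le> 1"
proof -
  define s where "s = 1 / (1 - b)"
  have s: "s * b + 1 = s" using b by (simp add: s_def field_simps)
  define N where "N = (\<Sum>j\<in>J. norm (z j) powr s)"
  show ?thesis
  proof (cases "N = 0")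
    case True
    then show ?thesis by (simp add: N_def s_def)
  next
    case False
    moreover have "N \<ge> 0" by (simp add: N_def sum_nonneg)
    ultimately have N: "N > 0" by simp
    define v where "v = (\<lambda>j. norm (z j) powr s / N)"
    \<comment> \<open>\<open>norm (z j) / z j\<close> turns each product \<open>y j * z j\<close>
      into a nonnegative real; where \<open>z j = 0\<close>, division by zero makes
      \<open>y j = 0\<close>.\<close>
    define y where "y = (\<lambda>j. of_real (v j powr b * norm (z j)) / z j)"
    have v: "v \<in> weights J"
      using N by (auto simp: weights_def v_def sum_divide_distrib[symmetric] N_def)
    have "norm (y j) \<le> v j powr b" for j
      by (cases "z j = 0") (auto simp: y_def norm_divide norm_mult)
    then have "norm (\<Sum>j\<in>J. y j * z j) \<le> 1" using v by (intro bound) auto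
    moreover have "y j * z j = of_real (norm (z j) powr s / N powr b)" for j
    proof -
      have "y j * z j = of_real (v j powr b * norm (z j))"
        by (cases "z j = 0") (auto simp: y_def)
      also have "v j powr b * norm (z j) = norm (z j) powr s / N powr b"
        using powr_mult_base[of "norm (z j)" "s * b"] s
        by (simp add: v_def powr_divide powr_powr add.commute mult.commute)
      finally show ?thesis .
    qed
    ultimately have "norm (of_real (N / N powr b) :: 'k) \<le> 1"
      by (simp add: N_def sum_divide_distrib)
    then have "N / N powr b \<le> 1" using N by (simp only: norm_of_real)
    then have "N powr (1 - b) \<le> 1" using N by (simp add: powr_diff)
    then have "N \<le> 1 powr (1 / (1 - b))" using N b by (intro powr_le_imp_le_powr_inverse) auto
    then show ?thesis by (simp add: N_def s_def)
  qed
qed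

text \<open>The vectors with entries of modulus \<open>w i powr a\<close> and arbitrary signs are
  all admissible. Duality in the second variable bounds the image of each by 1, and Khinchine turns
  a good choice of signs into the square function.\<close>

lemma bounded_on_weights_imp_square_function:
  fixes c :: "'i \<Rightarrow> 'j \<Rightarrow> 'k::{real_normed_field, real_inner}"
  assumes fin: "finite I" "finite J" and b: "0 \<le> b" "b \<le> 1 / 2"
    and bound: "bounded_on_weights I J a b c 1" and w: "w \<in> weights I"
  shows "(\<Sum>j\<in>J. (\<Sum>i\<in>I. w i powr (2 * a) * norm (c i j) powr 2) powr (1 / (1 - b) / 2)) \<le> 12"
proof -
  define s where "s = 1 / (1 - b)"
  have s: "1 \<le> s" "s \<le> 2" using b by (auto simp: s_def field_simps)
  obtain \<epsilon> :: "'i \<Rightarrow> real" where \<epsilon>: "\<And>i. \<bar>\<epsilon> i\<bar> = 1"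
    and le: "(\<Sum>j\<in>J. (\<Sum>i\<in>I. (norm (w i powr a *\<^sub>R c i j))\<^sup>2) powr (s / 2))
      \<le> 12 * (\<Sum>j\<in>J. norm (\<Sum>i\<in>I. \<epsilon> i *\<^sub>R w i powr a *\<^sub>R c i j) powr s)"
    using exists_signs_Khinchine[OF fin(1) s, of "\<lambda>i j. w i powr a *\<^sub>R c i j" J] by blast
  define x where "x i = (of_real (\<epsilon> i * w i powr a) :: 'k)" for i
  have x: "norm (x i) \<le> w i powr a" for i
    by (simp add: x_def abs_mult \<epsilon> del: of_real_mult)
  have "(\<Sum>j\<in>J. norm (\<Sum>i\<in>I. x i * c i j) powr s) \<le> 1"
    unfolding s_def
  proof (rule sum_norm_powr_le_1_if_dual)
    fix v y assume v: "v \<in> weights J" "\<forall>j\<in>J. norm (y j :: 'k) \<le> v j powr b"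
    have "(\<Sum>j\<in>J. y j * (\<Sum>i\<in>I. x i * c i j)) = (\<Sum>i\<in>I. \<Sum>j\<in>J. x i * y j * c i j)"
      by (subst sum.swap) (simp add: sum_distrib_left mult_ac)
    then show "norm (\<Sum>j\<in>J. y j * (\<Sum>i\<in>I. x i * c i j)) \<le> 1"
      using bound v w x by (simp add: bounded_on_weights_def)
  qed (use fin b in auto)
  moreover have "\<epsilon> i *\<^sub>R w i powr a *\<^sub>R c i j = x i * c i j" for i j
    by (simp add: x_def scaleR_conv_of_real)
  moreover have "(norm (w i powr a *\<^sub>R c i j))\<^sup>2 = w i powr (2 * a) * norm (c i j) powr 2" for i j
  proof -
    have "(w i powr a)\<^sup>2 = w i powr (2 * a)"
      by (simp only: power2_eq_square mult_2 powr_add)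
    then show ?thesis by (simp add: power_mult_distrib)
  qed
  ultimately show ?thesis using le by (simp add: s_def del: powr_numeral)
qed

subsection \<open>Forms of norm one\<close>

lemma recip_PInf [simp]: "recip \<infinity> = 0"
  by (simp add: recip_def)

lemma recip_ereal [simp]: "x \<noteq> 0 \<Longrightarrow> recip (ereal x) = 1 / x"
  by (simp add: recip_def divide_ereal_def inverse_eq_divide)

lemma ereal_ge_1_cases:
  fixes p :: ereal
  assumes "1 \<le> p"
  obtains "p = \<infinity>" | x where "p = ereal x" "1 \<le> x"
  using assms by (cases p) auto

lemma recip_ge_0: "1 \<le> p \<Longrightarrow> 0 \<le> recip p"
  by (erule ereal_ge_1_cases) auto

lemma recip_less_half: "2 < p \<Longrightarrow> recip p < 1 / 2"
  by (cases p) (auto simp: field_simps)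

lemma recip_le_half: "2 \<le> p \<Longrightarrow> recip p \<le> 1 / 2"
  by (cases p) (auto simp: field_simps)

lemma conj_exponent_eq:
  assumes "2 \<le> q"
  shows "conj_exponent q = ereal (1 / (1 - recip q))"
proof (cases q)
  case (real x)
  then have "x \<ge> 2" using assms by simp
  then show ?thesis using real
    by (simp add: conj_exponent_def divide_ereal_def one_ereal_def inverse_eq_divide)
qed (use assms in \<open>auto simp: conj_exponent_def one_ereal_def\<close>)

lemma lp_norm_le_1I:
  assumes p: "1 \<le> p" and w: "w \<in> weights {1..n}"
    and x: "\<And>i. i \<in> {1..n} \<Longrightarrow> norm (x i) \<le> w i powr recip p"
  shows "lp_norm p n x \<le> 1"
  using p
proof (cases rule: ereal_ge_1_cases)
  case 1
  have "norm (x i) \<le> 1" if "i \<in> {1..n}" for i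
    using x[OF that] weights_powr_le_1[OF _ w that, of 0] 1 by simp
  then show ?thesis using 1 by (auto simp: lp_norm_def)
next
  case (2 r)
  have "(\<Sum>i=1..n. norm (x i) powr r) \<le> (\<Sum>i=1..n. w i)"
  proof (rule sum_mono)
    fix i assume "i \<in> {1..n}"
    then have "norm (x i) powr r \<le> (w i powr (1 / r)) powr r"
      using x 2 by (intro powr_mono2) auto
    then show "norm (x i) powr r \<le> w i"
      using 2 w by (simp add: powr_powr weights_def)
  qed
  also have "\<dots> \<le> 1" using w by (simp add: weights_def)
  finally have "\<bar>\<Sum>i=1..n. norm (x i) powr r\<bar> \<le> 1" by (simp add: sum_nonneg)
  then show ?thesis using 2 by (simp add: lp_norm_def powr_le1)
qed

lemma lp_norm_le_1E:
  assumes p: "1 \<le> p" and x: "lp_norm p n x \<le> 1"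
  obtains w where "w \<in> weights {1..n}" and "\<And>i. i \<in> {1..n} \<Longrightarrow> norm (x i) \<le> w i powr recip p"
  using p
proof (cases rule: ereal_ge_1_cases)
  case 1
  have "norm (x i) \<le> 1" if "i \<in> {1..n}" for i
  proof -
    have "norm (x i) \<le> Max (insert 0 ((\<lambda>i. norm (x i)) ` {1..n}))"
      using that by (intro Max_ge) auto
    also have "\<dots> = lp_norm p n x" using 1 by (simp add: lp_norm_def)
    finally show ?thesis using x by simp
  qed
  \<comment> \<open>The weights must be positive here: \<open>recip p = 0\<close>, and
    \<open>w i powr 0\<close> is 1 only for \<open>w i \<noteq> 0\<close>.\<close>
  moreover have "(\<lambda>i. 1 / real n) \<in> weights {1..n}" by (simp add: weights_def)
  ultimately show thesis using 1 by (intro that[of "\<lambda>i. 1 / real n"]) auto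
next
  case (2 r)
  define w where "w = (\<lambda>i. norm (x i) powr r)"
  have "sum w {1..n} powr (1 / r) \<le> 1"
    using x 2 by (simp add: lp_norm_def w_def)
  moreover have "0 \<le> sum w {1..n}" by (simp add: w_def sum_nonneg)
  ultimately have "sum w {1..n} \<le> 1 powr (1 / (1 / r))"
    using 2 by (intro powr_le_imp_le_powr_inverse) auto
  then have "w \<in> weights {1..n}" by (simp add: weights_def w_def)
  moreover have "norm (x i) \<le> w i powr recip p" for i
    using 2 by (simp add: w_def powr_powr)
  ultimately show thesis by (rule that)
qed

section \<open>Bilinear forms and their coefficient matrices\<close>

lemma unit_vec_Kspace [simp]: "i \<in> {1..n} \<Longrightarrow> unit_vec i \<in> Kspace n"
  by (auto simp: unit_vec_def Kspace_def)

lemma lp_norm_unit_vec_le_1: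
  assumes "1 \<le> p" "i \<in> {1..n}"
  shows "lp_norm p n (unit_vec i) \<le> 1"
  using assms by (intro lp_norm_le_1I[of p "\<lambda>k. if k = i then 1 else 0"])
    (auto simp: weights_def unit_vec_def)

text \<open>Induction over the truncations of \<open>x\<close> to its first \<open>m\<close>
  coordinates, which stay in \<open>Kspace n\<close>, where linearity is available.\<close>

lemma Kspace_functional_expansion:
  fixes L :: "(nat \<Rightarrow> 'k::real_normed_field) \<Rightarrow> 'k"
  assumes add: "\<And>x x'. x \<in> Kspace n \<Longrightarrow> x' \<in> Kspace n \<Longrightarrow> L (\<lambda>i. x i + x' i) = L x + L x'"
    and hom: "\<And>c x. x \<in> Kspace n \<Longrightarrow> L (\<lambda>i. c * x i) = c * L x"
    and x: "x \<in> Kspace n"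
  shows "L x = (\<Sum>i=1..n. x i * L (unit_vec i))"
proof -
  have "m \<le> n \<Longrightarrow> L (\<lambda>i. if i \<in> {1..m} then x i else 0) = (\<Sum>i=1..m. x i * L (unit_vec i))" for m
  proof (induction m)
    case 0
    have "L (\<lambda>i. 0 * x i) = 0 * L x" using x by (rule hom)
    then show ?case by simp
  next
    case (Suc m)
    have e: "(\<lambda>i. if i \<in> {1..Suc m} then x i else 0)
        = (\<lambda>i. (if i \<in> {1..m} then x i else 0) + x (Suc m) * unit_vec (Suc m) i)"
      by (auto simp: unit_vec_def fun_eq_iff le_Suc_eq)
    have "L (\<lambda>i. if i \<in> {1..Suc m} then x i else 0) = L (\<lambda>i. if i \<in> {1..m} then x i else 0) + L (\<lambda>i. x (Suc m) * unit_vec (Suc m) i)"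
      unfolding e using Suc.prems x by (intro add) (auto simp: Kspace_def unit_vec_def)
    also have "L (\<lambda>i. x (Suc m) * unit_vec (Suc m) i) = x (Suc m) * L (unit_vec (Suc m))"
      using Suc.prems by (intro hom) auto
    finally show ?case using Suc by simp
  qed
  from this[of n] have "L (\<lambda>i. if i \<in> {1..n} then x i else 0) = (\<Sum>i=1..n. x i * L (unit_vec i))"
    by simp
  moreover have "(\<lambda>i. if i \<in> {1..n} then x i else 0) = x" using x by (auto simp: Kspace_def)
  ultimately show ?thesis by simp
qed

lemma bilinear_form_expansion:
  assumes T: "bilinear_form n T" and x: "x \<in> Kspace n" and y: "y \<in> Kspace n"
  shows "T x y = (\<Sum>i=1..n. \<Sum>j=1..n. x i * y j * T (unit_vec i) (unit_vec j))"
proof -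
  have "T x y = (\<Sum>i=1..n. x i * T (unit_vec i) y)"
    using T y by (intro Kspace_functional_expansion[of n "\<lambda>x. T x y"] x) (auto simp: bilinear_form_def)
  also have "T (unit_vec i) y = (\<Sum>j=1..n. y j * T (unit_vec i) (unit_vec j))" if "i \<in> {1..n}" for i
    using T that y by (intro Kspace_functional_expansion) (auto simp: bilinear_form_def)
  then have "(\<Sum>i=1..n. x i * T (unit_vec i) y) = (\<Sum>i=1..n. \<Sum>j=1..n. x i * y j * T (unit_vec i) (unit_vec j))"
    by (simp add: sum_distrib_left mult.assoc)
  finally show ?thesis .
qed

text \<open>A crude bound whose purpose is finiteness: it makes the supremum in
  \<open>form_norm\<close> one over a bounded set.\<close>

lemma bounded_on_weights_sum_norm:
  fixes c :: "'i \<Rightarrow> 'j \<Rightarrow> 'k::real_normed_field"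
  assumes fin: "finite I" "finite J" and ab: "0 \<le> a" "0 \<le> b"
  shows "bounded_on_weights I J a b c (\<Sum>i\<in>I. \<Sum>j\<in>J. norm (c i j))"
  unfolding bounded_on_weights_def
proof (intro ballI allI impI)
  fix w v and x :: "'i \<Rightarrow> 'k" and y :: "'j \<Rightarrow> 'k"
  assume *: "w \<in> weights I" "v \<in> weights J" "\<forall>i\<in>I. norm (x i) \<le> w i powr a" "\<forall>j\<in>J. norm (y j) \<le> v j powr b"
  have "norm (x i) \<le> 1" if "i \<in> I" for i
    using *(3) weights_powr_le_1[OF fin(1) *(1) that ab(1)] that by force
  moreover have "norm (y j) \<le> 1" if "j \<in> J" for j
    using *(4) weights_powr_le_1[OF fin(2) *(2) that ab(2)] that by force
  ultimately have "norm (x i * y j * c i j) \<le> norm (c i j)" if "i \<in> I" "j \<in> J" for i j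
    using that by (simp add: norm_mult mult_left_le_one_le mult_le_one)
  then show "norm (\<Sum>i\<in>I. \<Sum>j\<in>J. x i * y j * c i j) \<le> (\<Sum>i\<in>I. \<Sum>j\<in>J. norm (c i j))"
    by (intro sum_norm_le) auto
qed

lemma bounded_on_weights_norm_le:
  assumes "bounded_on_weights {1..n} {1..n} (recip p) (recip q) (\<lambda>i j. T (unit_vec i) (unit_vec j)) K"
    and "bilinear_form n T" "1 \<le> p" "1 \<le> q"
    and xy: "x \<in> Kspace n" "y \<in> Kspace n" "lp_norm p n x \<le> 1" "lp_norm q n y \<le> 1"
  shows "norm (T x y) \<le> K"
proof -
  obtain w v where "w \<in> weights {1..n}" "\<And>i. i \<in> {1..n} \<Longrightarrow> norm (x i) \<le> w i powr recip p"
    "v \<in> weights {1..n}" "\<And>i. i \<in> {1..n} \<Longrightarrow> norm (y i) \<le> v i powr recip q"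
    using lp_norm_le_1E assms by metis
  then show ?thesis
    unfolding bilinear_form_expansion[OF assms(2) xy(1,2)]
    using assms(1) by (simp add: bounded_on_weights_def)
qed

lemma norm_le_form_norm:
  assumes T: "bilinear_form n T" and pq: "1 \<le> p" "1 \<le> q"
    and "x \<in> Kspace n" "y \<in> Kspace n" "lp_norm p n x \<le> 1" "lp_norm q n y \<le> 1"
  shows "norm (T x y) \<le> form_norm p q n T"
  unfolding form_norm_def
proof (rule cSup_upper)
  show "bdd_above {norm (T x y) |x y. x \<in> Kspace n \<and> y \<in> Kspace n \<and> lp_norm p n x \<le> 1 \<and> lp_norm q n y \<le> 1}"
    using bounded_on_weights_norm_le[OF bounded_on_weights_sum_norm T pq]
      recip_ge_0[OF pq(1)] recip_ge_0[OF pq(2)] by (intro bdd_aboveI) blast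
qed (use assms in blast)

lemma form_norm_le:
  assumes "\<And>x y. x \<in> Kspace n \<Longrightarrow> y \<in> Kspace n \<Longrightarrow> lp_norm p n x \<le> 1 \<Longrightarrow> lp_norm q n y \<le> 1 \<Longrightarrow> norm (T x y) \<le> K"
    and "1 \<le> p" "1 \<le> q"
  shows "form_norm p q n T \<le> K"
  unfolding form_norm_def
proof (rule cSup_least)
  have "(\<lambda>_. 0) \<in> Kspace n" by (simp add: Kspace_def)
  moreover have "lp_norm r n (\<lambda>_. 0) \<le> 1" if "1 \<le> r" for r
    using that by (intro lp_norm_le_1I[of r "\<lambda>_. 0"]) (auto simp: weights_def)
  ultimately show "{norm (T x y) |x y. x \<in> Kspace n \<and> y \<in> Kspace n \<and> lp_norm p n x \<le> 1 \<and> lp_norm q n y \<le> 1} \<noteq> {}"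
    using assms(2,3) by blast
qed (use assms in blast)

lemma unit_forms_bounded_on_weights:
  fixes T :: "(nat \<Rightarrow> 'k::real_normed_field) \<Rightarrow> (nat \<Rightarrow> 'k) \<Rightarrow> 'k"
  assumes T: "T \<in> unit_forms p q n" and pq: "1 \<le> p" "1 \<le> q"
  shows "bounded_on_weights {1..n} {1..n} (recip p) (recip q) (\<lambda>i j. T (unit_vec i) (unit_vec j)) 1"
  unfolding bounded_on_weights_def
proof (intro ballI allI impI)
  fix w v and x y :: "nat \<Rightarrow> 'k"
  assume *: "w \<in> weights {1..n}" "v \<in> weights {1..n}" "\<forall>i\<in>{1..n}. norm (x i) \<le> w i powr recip p"
    "\<forall>j\<in>{1..n}. norm (y j) \<le> v j powr recip q"
  \<comment> \<open>The weights control \<open>x\<close> and \<open>y\<close> on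
    \<open>{1..n}\<close> only, so the entries outside are set to 0 to land in
    \<open>Kspace n\<close>.\<close>
  define x' y' where "x' = (\<lambda>i. if i \<in> {1..n} then x i else 0)" and "y' = (\<lambda>i. if i \<in> {1..n} then y i else 0)"
  have K: "x' \<in> Kspace n" "y' \<in> Kspace n" by (auto simp: Kspace_def x'_def y'_def)
  have "norm (T x' y') \<le> form_norm p q n T"
    using T pq K * by (intro norm_le_form_norm lp_norm_le_1I[where w = w] lp_norm_le_1I[where w = v])
      (auto simp: unit_forms_def x'_def y'_def)
  also have "\<dots> = 1" using T by (simp add: unit_forms_def)
  also have "T x' y' = (\<Sum>i=1..n. \<Sum>j=1..n. x i * y j * T (unit_vec i) (unit_vec j))"
    using T bilinear_form_expansion[OF _ K, of T] by (simp add: unit_forms_def x'_def y'_def)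
  finally show "norm (\<Sum>i=1..n. \<Sum>j=1..n. x i * y j * T (unit_vec i) (unit_vec j)) \<le> 1" .
qed

section \<open>Normalised forms and the passage to \<open>M_sup\<close>\<close>

lemma mixed_sum_eq_lnorm:
  "mixed_sum r\<^sub>1 r\<^sub>2 n T = lnorm r\<^sub>2 {1..n} (\<lambda>i. lnorm r\<^sub>1 {1..n} (\<lambda>j. norm (T (unit_vec i) (unit_vec j))))"
  by (simp add: mixed_sum_def lnorm_def powr_powr)

lemma bdd_above_mixed_sum:
  fixes p q :: ereal
  assumes "1 \<le> p" "1 \<le> q" "0 < r\<^sub>1" "0 < r\<^sub>2"
  shows "bdd_above (mixed_sum r\<^sub>1 r\<^sub>2 n ` (unit_forms p q n :: ((nat \<Rightarrow> 'k::real_normed_field) \<Rightarrow> _) set))"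
proof (rule bdd_aboveI2)
  fix T :: "(nat \<Rightarrow> 'k) \<Rightarrow> (nat \<Rightarrow> 'k) \<Rightarrow> 'k"
  assume T: "T \<in> unit_forms p q n"
  have "norm (T (unit_vec i) (unit_vec j)) \<le> 1" if "i \<in> {1..n}" "j \<in> {1..n}" for i j
    using norm_le_form_norm[of n T p q "unit_vec i" "unit_vec j"] T assms that
    by (simp add: unit_forms_def lp_norm_unit_vec_le_1)
  then show "mixed_sum r\<^sub>1 r\<^sub>2 n T \<le> lnorm r\<^sub>2 {1..n} (\<lambda>i. lnorm r\<^sub>1 {1..n} (\<lambda>j. 1))"
    unfolding mixed_sum_eq_lnorm using assms by (intro lnorm_mono) auto
qed

text \<open>The form with coefficients \<open>c\<close> is divided by its norm \<open>N\<close>. The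
  nonzero coefficient makes \<open>N\<close> positive, and \<open>N \<le> K\<close> limits the loss
  in lower bounds.\<close>

lemma exists_unit_form:
  fixes c :: "nat \<Rightarrow> nat \<Rightarrow> 'k::real_normed_field"
  assumes c: "bounded_on_weights {1..n} {1..n} (recip p) (recip q) c K" and pq: "1 \<le> p" "1 \<le> q"
    and nz: "i\<^sub>0 \<in> {1..n}" "j\<^sub>0 \<in> {1..n}" "c i\<^sub>0 j\<^sub>0 \<noteq> 0"
  obtains T N where "T \<in> unit_forms p q n" and "0 < N" "N \<le> K"
    and "\<And>i j. i \<in> {1..n} \<Longrightarrow> j \<in> {1..n} \<Longrightarrow> T (unit_vec i) (unit_vec j) = c i j / of_real N"
proof -
  define T\<^sub>0 where "T\<^sub>0 x y = (\<Sum>i=1..n. \<Sum>j=1..n. x i * y j * c i j)" for x y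
  have bil: "bilinear_form n (\<lambda>x y. T\<^sub>0 x y / k)" for k
    by (simp add: bilinear_form_def T\<^sub>0_def algebra_simps sum.distrib sum_distrib_left add_divide_distrib)
  from this[of 1] have bil0: "bilinear_form n T\<^sub>0" by simp
  have unit: "T\<^sub>0 (unit_vec i) (unit_vec j) = c i j" if "i \<in> {1..n}" "j \<in> {1..n}" for i j
  proof -
    have "T\<^sub>0 (unit_vec i) (unit_vec j) = (\<Sum>k=1..n. \<Sum>l=1..n. if l = j then if k = i then c k l else 0 else 0)"
      unfolding T\<^sub>0_def unit_vec_def by (intro sum.cong refl) auto
    also have "\<dots> = (\<Sum>k=1..n. if k = i then c k j else 0)"
      using that by simp
    finally show ?thesis using that by simp
  qed
  define N where "N = form_norm p q n T\<^sub>0"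
  have "norm (c i\<^sub>0 j\<^sub>0) \<le> N"
    using norm_le_form_norm[OF bil0 pq, of "unit_vec i\<^sub>0" "unit_vec j\<^sub>0"] unit nz pq
    by (simp add: N_def lp_norm_unit_vec_le_1)
  then have N0: "0 < N" using nz(3) by (smt (verit) zero_less_norm_iff)
  have "bounded_on_weights {1..n} {1..n} (recip p) (recip q) (\<lambda>i j. T\<^sub>0 (unit_vec i) (unit_vec j)) K"
    using c unit by (simp add: bounded_on_weights_def)
  then have NK: "N \<le> K"
    unfolding N_def using bil0 pq by (intro form_norm_le bounded_on_weights_norm_le[where T = T\<^sub>0])
  define T where "T = (\<lambda>x y. T\<^sub>0 x y / of_real N)"
  have norm_T: "norm (T x y) = norm (T\<^sub>0 x y) / N" for x y
    using N0 by (simp add: T_def norm_divide)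
  have bilT: "bilinear_form n T" unfolding T_def by (rule bil)
  have "form_norm p q n T \<le> 1"
    using norm_le_form_norm[OF bil0 pq] N0 pq
    by (intro form_norm_le) (auto simp: norm_T N_def)
  \<comment> \<open>Homogeneity: \<open>N\<close> is the least bound for \<open>T\<^sub>0\<close>,
    and \<open>N * form_norm p q n T\<close> is a bound for it as well.\<close>
  moreover have "N \<le> N * form_norm p q n T"
  proof -
    have "norm (T\<^sub>0 x y) \<le> N * form_norm p q n T"
      if "x \<in> Kspace n" "y \<in> Kspace n" "lp_norm p n x \<le> 1" "lp_norm q n y \<le> 1" for x y
      using norm_le_form_norm[OF bilT pq that] N0 by (simp add: norm_T field_simps)
    then show ?thesis using pq by (subst N_def) (intro form_norm_le)
  qed
  ultimately have "T \<in> unit_forms p q n" using bilT N0 by (simp add: unit_forms_def)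
  then show thesis using N0 NK unit by (intro that[of T N]) (auto simp: T_def)
qed

text \<open>Lower bounds for \<open>M_sup\<close> thus reduce to a coefficient matrix with large
  mixed norm and an upper estimate \<open>K\<close> of its form norm.\<close>

lemma M_sup_ge:
  fixes c :: "nat \<Rightarrow> nat \<Rightarrow> 'k::real_normed_field"
  assumes c: "bounded_on_weights {1..n} {1..n} (recip p) (recip q) c K" and pq: "1 \<le> p" "1 \<le> q"
    and r: "0 < r\<^sub>1" "0 < r\<^sub>2" and nz: "i\<^sub>0 \<in> {1..n}" "j\<^sub>0 \<in> {1..n}" "c i\<^sub>0 j\<^sub>0 \<noteq> 0"
  shows "lnorm r\<^sub>2 {1..n} (\<lambda>i. lnorm r\<^sub>1 {1..n} (\<lambda>j. norm (c i j))) / K \<le> M_sup TYPE('k) p q r\<^sub>1 r\<^sub>2 n"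
proof -
  obtain T :: "(nat \<Rightarrow> 'k) \<Rightarrow> (nat \<Rightarrow> 'k) \<Rightarrow> 'k" and N
    where T: "T \<in> unit_forms p q n" and N: "0 < N" "N \<le> K"
    and e: "\<And>i j. i \<in> {1..n} \<Longrightarrow> j \<in> {1..n} \<Longrightarrow> T (unit_vec i) (unit_vec j) = c i j / of_real N"
    using exists_unit_form[OF c pq nz] by blast
  define L where "L = lnorm r\<^sub>2 {1..n} (\<lambda>i. lnorm r\<^sub>1 {1..n} (\<lambda>j. norm (c i j)))"
  have "mixed_sum r\<^sub>1 r\<^sub>2 n T = lnorm r\<^sub>2 {1..n} (\<lambda>i. lnorm r\<^sub>1 {1..n} (\<lambda>j. inverse N * norm (c i j)))"
  proof -
    have "norm (T (unit_vec i) (unit_vec j)) = inverse N * norm (c i j)" if "i \<in> {1..n}" "j \<in> {1..n}" for i j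
      unfolding e[OF that] using N by (simp add: norm_mult norm_inverse divide_inverse mult.commute)
    then show ?thesis by (simp add: mixed_sum_eq_lnorm lnorm_def)
  qed
  also have "\<dots> = L / N"
    using r N by (simp add: lnorm_cmult L_def divide_inverse)
  finally have "L / N = mixed_sum r\<^sub>1 r\<^sub>2 n T" by simp
  moreover have "L / K \<le> L / N" using N by (intro divide_left_mono) (auto simp: L_def)
  moreover have "mixed_sum r\<^sub>1 r\<^sub>2 n T \<le> M_sup TYPE('k) p q r\<^sub>1 r\<^sub>2 n"
    unfolding M_sup_def using T bdd_above_mixed_sum[OF pq r] by (intro cSUP_upper)
  ultimately show ?thesis by (simp add: L_def)
qed

lemma M_sup_power_bound:
  fixes p q :: ereal and C :: real
  assumes pq: "1 \<le> p" "1 \<le> q" and r: "0 < r\<^sub>1" "0 < r\<^sub>2"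
    and le: "\<And>n (T :: (nat \<Rightarrow> 'k) \<Rightarrow> (nat \<Rightarrow> 'k) \<Rightarrow> 'k::real_normed_field).
      1 \<le> n \<Longrightarrow> T \<in> unit_forms p q n \<Longrightarrow> mixed_sum r\<^sub>1 r\<^sub>2 n T \<le> C * real n powr t"
  shows "power_bound (M_sup TYPE('k) p q r\<^sub>1 r\<^sub>2) t"
  unfolding power_bound_def
proof (rule bigoI[of _ C], rule eventually_at_top_linorderI[of 1])
  fix n :: nat assume n: "1 \<le> n"
  \<comment> \<open>The all-ones matrix serves to show that \<open>unit_forms p q n\<close> is
    nonempty, as the least-upper-bound argument and the sign of \<open>M_sup\<close>
    require.\<close>
  have b: "bounded_on_weights {1..n} {1..n} (recip p) (recip q) (\<lambda>i j. 1 :: 'k) (\<Sum>i=1..n. \<Sum>j=1..n. norm (1 :: 'k))"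
    using pq by (intro bounded_on_weights_sum_norm recip_ge_0) auto
  obtain T :: "(nat \<Rightarrow> 'k) \<Rightarrow> (nat \<Rightarrow> 'k) \<Rightarrow> 'k" where T: "T \<in> unit_forms p q n"
  proof -
    have "1 \<in> {1..n}" using n by simp
    then show thesis using exists_unit_form[OF b pq, of 1 1] that one_neq_zero by blast
  qed
  have "0 \<le> mixed_sum r\<^sub>1 r\<^sub>2 n T" by (simp add: mixed_sum_eq_lnorm)
  also have "\<dots> \<le> M_sup TYPE('k) p q r\<^sub>1 r\<^sub>2 n"
    unfolding M_sup_def using T bdd_above_mixed_sum[OF pq r] by (intro cSUP_upper)
  finally have "0 \<le> M_sup TYPE('k) p q r\<^sub>1 r\<^sub>2 n" .
  moreover have "M_sup TYPE('k) p q r\<^sub>1 r\<^sub>2 n \<le> C * real n powr t"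
    unfolding M_sup_def using T le[OF n] by (intro cSUP_least) auto
  ultimately show "norm (M_sup TYPE('k) p q r\<^sub>1 r\<^sub>2 n) \<le> C * norm (real n powr t)" by simp
qed

text \<open>An estimate along a sequence tending to infinity refutes any smaller exponent; powers of
  2 are the dimensions in which the Hadamard matrices below exist.\<close>

lemma optimal_exponentI:
  assumes M: "\<And>k. real (2 ^ k) powr t\<^sub>0 \<le> M (2 ^ k)"
  shows "optimal_exponent M t\<^sub>0"
  unfolding optimal_exponent_def
proof (intro allI impI, rule ccontr)
  fix t assume "power_bound M t" and "\<not> t\<^sub>0 \<le> t"
  then obtain C where "eventually (\<lambda>n. norm (M n) \<le> C * norm (real n powr t)) at_top"
    unfolding power_bound_def by (elim landau_o.bigE)
  then obtain n\<^sub>0 where n\<^sub>0: "\<And>n. n \<ge> n\<^sub>0 \<Longrightarrow> norm (M n) \<le> C * norm (real n powr t)"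
    by (auto simp: eventually_at_top_linorder)
  define B where "B = 2 powr (t\<^sub>0 - t)"
  have "B > 1" using \<open>\<not> t\<^sub>0 \<le> t\<close> by (simp add: B_def)
  then obtain k where k: "C < B ^ k" using real_arch_pow by blast
  define m where "m = max k n\<^sub>0"
  have "n\<^sub>0 \<le> m" by (simp add: m_def)
  then have "n\<^sub>0 \<le> 2 ^ m" using less_exp[of m] by linarith
  then have "real (2 ^ m) powr t\<^sub>0 \<le> C * real (2 ^ m) powr t"
    using n\<^sub>0[of "2 ^ m"] M[of m] by simp
  then have "real (2 ^ m) powr (t\<^sub>0 - t) \<le> C" by (simp add: powr_diff field_simps)
  moreover have "real (2 ^ m) powr (t\<^sub>0 - t) = B ^ m"
    by (simp add: B_def powr_realpow[symmetric] powr_powr mult.commute)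
  moreover have "B ^ k \<le> B ^ m" using \<open>B > 1\<close> by (intro power_increasing) (auto simp: m_def)
  ultimately show False using k by linarith
qed

subsection \<open>Upper bounds\<close>

text \<open>The estimate on the critical segment, with a constant independent of the dimension: both
  endpoints follow from square functions in the two variables, and the inner and the outer norm are
  interpolated with the same \<open>\<theta>\<close>.\<close>

lemma bounded_on_weights_imp_mixed_lnorm_le:
  fixes c :: "'i \<Rightarrow> 'j \<Rightarrow> 'k::{real_normed_field, real_inner}"
  assumes fin: "finite I" "finite J" and a: "0 \<le> a" "a < 1 / 2" and b: "0 \<le> b" "b \<le> 1 / 2"
    and bound: "bounded_on_weights I J a b c 1" and r: "0 < r" "1 / 2 \<le> 1 / r" "1 / r \<le> 1 - b"
  shows "lnorm (1 / (3 / 2 - (a + b) - 1 / r)) I (\<lambda>i. lnorm r J (\<lambda>j. norm (c i j)))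
    \<le> 12 powr (2 / (1 - 2 * a))"
proof -
  define C where "C = (12::real) powr (2 / (1 - 2 * a))"
  define u where "u = (\<lambda>i j. norm (c i j))"
  define s where "s = 1 / (1 - b)"
  define \<rho> where "\<rho> = 1 / (3 / 2 - (a + b) - 1 / r)"
  \<comment> \<open>\<open>\<theta>\<close> locates \<open>1 / r\<close> between
    \<open>1 / 2\<close> and \<open>1 - b\<close>. For \<open>b = 1 / 2\<close> the segment
    degenerates to a point and any share would do; 0 is taken.\<close>
  define \<theta> where "\<theta> = (if b = 1 / 2 then 0 else (1 / r - 1 / 2) / (1 / 2 - b))"
  have \<theta>: "0 \<le> \<theta>" "\<theta> \<le> 1" and e: "1 / r = \<theta> * (1 - b) + (1 - \<theta>) / 2"
  proof -
    show "0 \<le> \<theta>" using r b by (auto simp: \<theta>_def intro!: divide_nonneg_nonneg)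
    have "(1 / r - 1 / 2) / (1 / 2 - b) \<le> (1 / 2 - b) / (1 / 2 - b)"
      using r b by (intro divide_right_mono) auto
    then show "\<theta> \<le> 1" by (auto simp: \<theta>_def)
    have "\<theta> * (1 / 2 - b) = 1 / r - 1 / 2"
    proof (cases "b = 1 / 2")
      case True
      then have "1 / r - 1 / 2 = 0" using r by linarith
      moreover have "\<theta> * (1 / 2 - b) = 0" using True by simp
      ultimately show ?thesis by linarith
    qed (simp add: \<theta>_def)
    then show "1 / r = \<theta> * (1 - b) + (1 - \<theta>) / 2" by (simp add: field_simps)
  qed
  note H1 = bounded_on_weights_imp_square_function[OF fin b bound, folded u_def]
  have H2: "(\<Sum>i\<in>I. (\<Sum>j\<in>J. v j powr (2 * b) * u i j powr 2) powr (1 / (1 - a) / 2)) \<le> 12"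
    if "v \<in> weights J" for v
    unfolding u_def using a that
    by (intro bounded_on_weights_imp_square_function[OF fin(2,1) _ _ bounded_on_weights_transpose[OF bound]]) auto
  have edge1: "lnorm (1 / (1 / 2 - a)) I (\<lambda>i. lnorm s J (u i)) \<le> C"
  proof -
    have "lnorm (1 / (1 / 2 - a)) I (\<lambda>i. lnorm s J (u i)) \<le> 12 powr (1 / s)"
      using fin a b H1 by (intro lnorm_lnorm_le_endpoint_conj) (auto simp: u_def s_def field_simps)
    also have "\<dots> \<le> C"
    proof -
      have "1 / s \<le> 1" using b by (simp add: s_def)
      also have "1 \<le> 2 / (1 - 2 * a)" using a by (simp add: field_simps)
      finally show ?thesis unfolding C_def by (intro powr_mono) auto
    qed
    finally show ?thesis .
  qed
  have edge2: "lnorm (1 / (1 - a - b)) I (\<lambda>i. lnorm 2 J (u i)) \<le> C"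
    unfolding C_def using fin a b H1 H2 by (intro lnorm_lnorm_le_endpoint_2) (auto simp: u_def)
  have inner: "lnorm r J (u i) \<le> lnorm s J (u i) powr \<theta> * lnorm 2 J (u i) powr (1 - \<theta>)" for i
  proof -
    have "u i j = u i j powr \<theta> * u i j powr (1 - \<theta>)" for j
      by (simp add: u_def powr_add[symmetric])
    then have "lnorm r J (u i) = lnorm r J (\<lambda>j. u i j powr \<theta> * u i j powr (1 - \<theta>))"
      by simp
    also have "\<dots> \<le> lnorm s J (u i) powr \<theta> * lnorm 2 J (u i) powr (1 - \<theta>)"
      using fin \<theta> r b e by (intro lnorm_interpolate) (auto simp: u_def s_def)
    finally show ?thesis .
  qed
  \<comment> \<open>The outer reciprocal exponent is an affine function of \<open>1 / r\<close>,
    hence the inner share \<open>\<theta>\<close> is also the outer one.\<close>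
  have \<rho>: "1 / \<rho> = \<theta> * (1 / 2 - a) + (1 - \<theta>) * (1 - a - b)"
    unfolding \<rho>_def e by (simp add: field_simps)
  have "\<rho> > 0" using r a by (simp add: \<rho>_def)
  have "lnorm \<rho> I (\<lambda>i. lnorm r J (u i))
      \<le> lnorm \<rho> I (\<lambda>i. lnorm s J (u i) powr \<theta> * lnorm 2 J (u i) powr (1 - \<theta>))"
    using \<open>\<rho> > 0\<close> by (intro lnorm_mono inner) auto
  also have "\<dots> \<le> lnorm (1 / (1 / 2 - a)) I (\<lambda>i. lnorm s J (u i)) powr \<theta>
      * lnorm (1 / (1 - a - b)) I (\<lambda>i. lnorm 2 J (u i)) powr (1 - \<theta>)"
    using fin \<theta> a b \<rho> \<open>\<rho> > 0\<close> by (intro lnorm_interpolate) auto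
  also have "\<dots> \<le> C powr \<theta> * C powr (1 - \<theta>)"
    using edge1 edge2 \<theta> by (intro mult_mono powr_mono2) auto
  also have "\<dots> = C"
    by (simp add: powr_add[symmetric] C_def)
  finally show ?thesis by (simp add: \<rho>_def u_def C_def)
qed

text \<open>The parameter \<open>s\<close> selects a point of the critical segment. The exponent of
  \<open>n\<close> is the cost of moving from there to the given pair, and each region is settled by
  a suitable \<open>s\<close>.\<close>

lemma M_sup_power_bound_max:
  fixes p q :: ereal
  assumes p: "2 < p" and q: "2 \<le> q" and r: "0 < r\<^sub>1" "0 < r\<^sub>2"
    and s: "0 < s" "1 / 2 \<le> 1 / s" "1 / s \<le> 1 - recip q"
  shows "power_bound (M_sup TYPE('k::{real_normed_field, real_inner}) p q r\<^sub>1 r\<^sub>2)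
    (max 0 (1 / r\<^sub>1 - 1 / s) + max 0 (1 / r\<^sub>2 - (3 / 2 - (recip p + recip q) - 1 / s)))"
proof -
  have pq: "1 \<le> p" "1 \<le> q"
    using p q by (auto intro: order_trans[of 1 "2::ereal"] order_trans[OF _ less_imp_le])
  note ab = recip_ge_0[OF pq(1)] recip_less_half[OF p] recip_ge_0[OF pq(2)] recip_le_half[OF q]
  define e where "e = 3 / 2 - (recip p + recip q) - 1 / s"
  have e: "e > 0" using ab s by (simp add: e_def)
  show ?thesis
    unfolding e_def[symmetric]
  proof (rule M_sup_power_bound[OF pq r])
    fix n and T :: "(nat \<Rightarrow> 'k) \<Rightarrow> (nat \<Rightarrow> 'k) \<Rightarrow> 'k"
    assume n: "1 \<le> n" and T: "T \<in> unit_forms p q n"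
    have "mixed_sum r\<^sub>1 r\<^sub>2 n T \<le> real n powr max 0 (1 / r\<^sub>1 - 1 / s) * real n powr max 0 (1 / r\<^sub>2 - 1 / (1 / e))
      * lnorm (1 / e) {1..n} (\<lambda>i. lnorm s {1..n} (\<lambda>j. norm (T (unit_vec i) (unit_vec j))))"
      unfolding mixed_sum_eq_lnorm
      using lnorm_lnorm_le_card[of "{1..n}" "{1..n}" "\<lambda>i j. norm (T (unit_vec i) (unit_vec j))" r\<^sub>1 r\<^sub>2 s "1 / e"] n r s e
      by simp
    also have "\<dots> \<le> real n powr max 0 (1 / r\<^sub>1 - 1 / s) * real n powr max 0 (1 / r\<^sub>2 - 1 / (1 / e)) * 12 powr (2 / (1 - 2 * recip p))"
      using bounded_on_weights_imp_mixed_lnorm_le[OF _ _ ab unit_forms_bounded_on_weights[OF T pq] s]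
      by (intro mult_left_mono) (auto simp: e_def)
    finally show "mixed_sum r\<^sub>1 r\<^sub>2 n T
      \<le> 12 powr (2 / (1 - 2 * recip p)) * real n powr (max 0 (1 / r\<^sub>1 - 1 / s) + max 0 (1 / r\<^sub>2 - e))"
      by (simp add: powr_add mult_ac)
  qed
qed

subsection \<open>Extremal forms\<close>

text \<open>Sylvester's Hadamard matrices, with rows and columns indexed by \<open>{1..2 ^ k}\<close>.\<close>

fun walsh :: "nat \<Rightarrow> nat \<Rightarrow> nat \<Rightarrow> real" where
  "walsh 0 i j = 1"
| "walsh (Suc k) i j =
     (if 2 ^ k < i \<and> 2 ^ k < j then - 1 else 1) *
     walsh k (if 2 ^ k < i then i - 2 ^ k else i) (if 2 ^ k < j then j - 2 ^ k else j)"

lemma abs_walsh [simp]: "\<bar>walsh k i j\<bar> = 1"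
  by (induction k arbitrary: i j) (auto simp: abs_mult)

lemma sum_1_add:
  fixes f :: "nat \<Rightarrow> 'b::comm_monoid_add"
  shows "(\<Sum>i=1..m + n. f i) = (\<Sum>i=1..m. f i) + (\<Sum>i=1..n. f (m + i))"
  by (induction n) (auto simp: add.assoc)

text \<open>The matrix is a multiple of an isometry. On the two halves of the columns the block
  recursion produces \<open>X j + Y j\<close> and \<open>X j - Y j\<close>, and the parallelogram
  law closes the induction.\<close>

lemma walsh_orthogonal:
  fixes x :: "nat \<Rightarrow> 'k::real_inner"
  shows "(\<Sum>j=1..2 ^ k. (norm (\<Sum>i=1..2 ^ k. walsh k i j *\<^sub>R x i))\<^sup>2) = 2 ^ k * (\<Sum>i=1..2 ^ k. (norm (x i))\<^sup>2)"
proof (induction k arbitrary: x)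
  case (Suc k)
  define n :: nat where "n = 2 ^ k"
  define X where "X j = (\<Sum>i=1..n. walsh k i j *\<^sub>R x i)" for j
  define Y where "Y j = (\<Sum>i=1..n. walsh k i j *\<^sub>R x (n + i))" for j
  have n2: "2 ^ Suc k = n + n" by (simp add: n_def)
  have low: "(\<Sum>i=1..n + n. walsh (Suc k) i j *\<^sub>R x i) = X j + Y j" if "j \<in> {1..n}" for j
    using that unfolding sum_1_add X_def Y_def by (simp add: n_def[symmetric])
  have high: "(\<Sum>i=1..n + n. walsh (Suc k) i (n + j) *\<^sub>R x i) = X j - Y j" if "j \<in> {1..n}" for j
    using that unfolding sum_1_add X_def Y_def by (simp add: n_def[symmetric] sum_negf)
  have "(\<Sum>j=1..n + n. (norm (\<Sum>i=1..n + n. walsh (Suc k) i j *\<^sub>R x i))\<^sup>2)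
      = (\<Sum>j=1..n. (norm (X j + Y j))\<^sup>2 + (norm (X j - Y j))\<^sup>2)"
    unfolding sum_1_add[where f = "\<lambda>j. (norm (\<Sum>i=1..n + n. walsh (Suc k) i j *\<^sub>R x i))\<^sup>2"]
    by (simp only: low high sum.distrib cong: sum.cong)
  also have "\<dots> = 2 * ((\<Sum>j=1..n. (norm (X j))\<^sup>2) + (\<Sum>j=1..n. (norm (Y j))\<^sup>2))"
    by (simp only: norm_add_diff_square sum_distrib_left[symmetric] sum.distrib)
  also have "\<dots> = 2 ^ Suc k * (\<Sum>i=1..n + n. (norm (x i))\<^sup>2)"
    unfolding sum_1_add X_def Y_def n_def Suc.IH by (simp add: algebra_simps)
  finally show ?case unfolding n2 .
qed auto

text \<open>Cauchy-Schwarz in \<open>j\<close> and orthogonality reduce the claim to the Euclidean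
  norms of \<open>x\<close> and \<open>y\<close>, whose squares are at most
  \<open>n powr (1 - 2 * a)\<close> and \<open>n powr (1 - 2 * b)\<close>; the exponent is half of
  \<open>(1 - 2 * b) + 1 + (1 - 2 * a)\<close>.\<close>

lemma bounded_on_weights_walsh:
  assumes ab: "0 \<le> a" "a \<le> 1 / 2" "0 \<le> b" "b \<le> 1 / 2"
  shows "bounded_on_weights {1..2 ^ k} {1..2 ^ k} a b
    (\<lambda>i j. of_real (walsh k i j) :: 'k::{real_normed_field, real_inner}) (real (2 ^ k) powr (3 / 2 - (a + b)))"
  unfolding bounded_on_weights_def
proof (intro ballI allI impI)
  define n where "n = (2 ^ k :: nat)"
  fix w v and x y :: "nat \<Rightarrow> 'k"
  assume *: "w \<in> weights {1..2 ^ k}" "v \<in> weights {1..2 ^ k}"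
    "\<forall>i\<in>{1..2 ^ k}. norm (x i) \<le> w i powr a" "\<forall>j\<in>{1..2 ^ k}. norm (y j) \<le> v j powr b"
  note * = *[folded n_def]
  define Z where "Z j = (\<Sum>i=1..n. walsh k i j *\<^sub>R x i)" for j
  have sq: "(\<Sum>i=1..n. (norm (z i))\<^sup>2) \<le> real n powr (1 - 2 * e)"
    if "u \<in> weights {1..n}" "\<forall>i\<in>{1..n}. norm (z i) \<le> u i powr e" "0 \<le> e" "e \<le> 1 / 2"
    for u e and z :: "nat \<Rightarrow> 'k"
  proof -
    have "(\<Sum>i=1..n. (norm (z i))\<^sup>2) \<le> (\<Sum>i=1..n. (u i powr e)\<^sup>2)"
      using that by (intro sum_mono power_mono) auto
    also have "\<dots> = (\<Sum>i=1..n. u i powr (2 * e))"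
      by (simp only: power2_eq_square mult_2 powr_add)
    also have "\<dots> \<le> real (card {1..n}) powr (1 - 2 * e)"
      using that by (intro weights_sum_powr_le_card) auto
    finally show ?thesis by simp
  qed
  have "(\<Sum>j=1..n. norm (y j) * norm (Z j))\<^sup>2 \<le> (\<Sum>j=1..n. (norm (y j))\<^sup>2) * (\<Sum>j=1..n. (norm (Z j))\<^sup>2)"
    by (rule Cauchy_Schwarz_ineq_sum)
  also have "(\<Sum>j=1..n. (norm (Z j))\<^sup>2) = real n * (\<Sum>i=1..n. (norm (x i))\<^sup>2)"
    unfolding Z_def n_def using walsh_orthogonal[of k x] by simp
  also have "(\<Sum>j=1..n. (norm (y j))\<^sup>2) * \<dots> \<le> real n powr (1 - 2 * b) * (real n * real n powr (1 - 2 * a))"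
  proof (intro mult_mono)
    show "(\<Sum>j=1..n. (norm (y j))\<^sup>2) \<le> real n powr (1 - 2 * b)"
      using * ab by (intro sq[of v]) auto
    show "(\<Sum>i=1..n. (norm (x i))\<^sup>2) \<le> real n powr (1 - 2 * a)"
      using * ab by (intro sq[of w]) auto
  qed (auto intro!: mult_nonneg_nonneg sum_nonneg)
  also have "\<dots> = real n powr ((1 - 2 * b) + 1 + (1 - 2 * a))"
    unfolding powr_add by simp
  also have "\<dots> = real n powr (2 * (3 / 2 - (a + b)))"
    by (rule arg_cong[where f = "(powr) (real n)"]) simp
  also have "\<dots> = (real n powr (3 / 2 - (a + b)))\<^sup>2"
    by (simp only: power2_eq_square mult_2 powr_add)
  finally have le: "(\<Sum>j=1..n. norm (y j) * norm (Z j)) \<le> real n powr (3 / 2 - (a + b))"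
    by (rule power2_le_imp_le) simp
  have "(\<Sum>i=1..n. \<Sum>j=1..n. x i * y j * of_real (walsh k i j)) = (\<Sum>j=1..n. y j * Z j)"
    by (subst sum.swap) (simp add: Z_def scaleR_conv_of_real sum_distrib_left mult_ac)
  then have "norm (\<Sum>i=1..n. \<Sum>j=1..n. x i * y j * of_real (walsh k i j)) \<le> (\<Sum>j=1..n. norm (y j) * norm (Z j))"
    by (simp only: norm_mult[symmetric]) (rule norm_sum)
  also note le
  finally show "norm (\<Sum>i=1..2 ^ k. \<Sum>j=1..2 ^ k. x i * y j * of_real (walsh k i j))
      \<le> real (2 ^ k) powr (3 / 2 - (a + b))"
    by (simp add: n_def)
qed

text \<open>The form is \<open>x 1\<close> times the sum of the \<open>y j\<close>; the first factor
  is at most 1 and the second is estimated by comparing sums of powers of a weight with the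
  cardinality.\<close>

lemma bounded_on_weights_row:
  assumes ab: "0 \<le> a" "0 \<le> b" "b \<le> 1" and "1 \<le> n"
  shows "bounded_on_weights {1..n} {1..n} a b
    (\<lambda>i j. if i = 1 then 1 else 0 :: 'k::real_normed_field) (real n powr (1 - b))"
  unfolding bounded_on_weights_def
proof (intro ballI allI impI)
  fix w v and x y :: "nat \<Rightarrow> 'k"
  assume *: "w \<in> weights {1..n}" "v \<in> weights {1..n}"
    "\<forall>i\<in>{1..n}. norm (x i) \<le> w i powr a" "\<forall>j\<in>{1..n}. norm (y j) \<le> v j powr b"
  have "norm (x 1) \<le> 1"
    using *(3) weights_powr_le_1[OF _ *(1) _ ab(1), of 1] \<open>1 \<le> n\<close> by force
  moreover have "(\<Sum>j=1..n. norm (y j)) \<le> real n powr (1 - b)"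
  proof -
    have "(\<Sum>j=1..n. norm (y j)) \<le> (\<Sum>j=1..n. v j powr b)"
      using * by (intro sum_mono) auto
    also have "\<dots> \<le> real (card {1..n}) powr (1 - b)"
      using * ab by (intro weights_sum_powr_le_card) auto
    finally show ?thesis by simp
  qed
  ultimately have "norm (x 1) * (\<Sum>j=1..n. norm (y j)) \<le> 1 * real n powr (1 - b)"
    by (intro mult_mono) (auto intro: sum_nonneg)
  moreover have "norm (x 1 * (\<Sum>j=1..n. y j)) \<le> norm (x 1) * (\<Sum>j=1..n. norm (y j))"
    by (simp add: norm_mult mult_left_mono norm_sum)
  moreover have "(\<Sum>i=1..n. \<Sum>j=1..n. x i * y j * (if i = 1 then 1 else 0)) = x 1 * (\<Sum>j=1..n. y j)"
  proof -
    have "(\<Sum>i=1..n. \<Sum>j=1..n. x i * y j * (if i = 1 then 1 else 0))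
        = (\<Sum>i=1..n. if i = 1 then x 1 * (\<Sum>j=1..n. y j) else 0)"
      by (intro sum.cong refl) (auto simp: sum_distrib_left)
    then show ?thesis using \<open>1 \<le> n\<close> by simp
  qed
  ultimately show "norm (\<Sum>i=1..n. \<Sum>j=1..n. x i * y j * (if i = 1 then 1 else 0)) \<le> real n powr (1 - b)"
    by simp
qed

lemma bounded_on_weights_diagonal:
  assumes ab: "0 \<le> a" "0 \<le> b" "a + b \<le> 1"
  shows "bounded_on_weights {1..n} {1..n} a b
    (\<lambda>i j. if i = j then 1 else 0 :: 'k::real_normed_field) (real n powr (1 - a - b))"
  unfolding bounded_on_weights_def
proof (intro ballI allI impI)
  fix w v and x y :: "nat \<Rightarrow> 'k"
  assume *: "w \<in> weights {1..n}" "v \<in> weights {1..n}"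
    "\<forall>i\<in>{1..n}. norm (x i) \<le> w i powr a" "\<forall>j\<in>{1..n}. norm (y j) \<le> v j powr b"
  have "(\<Sum>i=1..n. \<Sum>j=1..n. x i * y j * (if i = j then 1 else 0)) = (\<Sum>i=1..n. x i * y i)"
  proof (rule sum.cong[OF refl])
    fix i assume "i \<in> {1..n}"
    moreover have "(\<Sum>j=1..n. x i * y j * (if i = j then 1 else 0)) = (\<Sum>j=1..n. if i = j then x i * y j else 0)"
      by (intro sum.cong) auto
    ultimately show "(\<Sum>j=1..n. x i * y j * (if i = j then 1 else 0)) = x i * y i" by simp
  qed
  also have "norm \<dots> \<le> (\<Sum>i=1..n. w i powr a * v i powr b)"
    using * by (intro sum_norm_le) (auto simp: norm_mult intro!: mult_mono)
  also have "\<dots> \<le> real (card {1..n}) powr (1 - a - b)"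
    using * ab by (intro weights_sum_mult_powr_le_card) auto
  finally show "norm (\<Sum>i=1..n. \<Sum>j=1..n. x i * y j * (if i = j then 1 else 0)) \<le> real n powr (1 - a - b)"
    by simp
qed

lemma lnorm_const: "finite I \<Longrightarrow> 0 < r \<Longrightarrow> 0 \<le> c \<Longrightarrow> lnorm r I (\<lambda>_. c) = real (card I) powr (1 / r) * c"
  by (simp add: lnorm_def powr_mult powr_powr)

lemma lnorm_single:
  assumes "finite I" "k \<in> I" "0 < r" "0 \<le> c"
  shows "lnorm r I (\<lambda>i. if i = k then c else 0) = c"
proof -
  have "(\<Sum>i\<in>I. (if i = k then c else 0) powr r) = (\<Sum>i\<in>I. if i = k then c powr r else 0)"
    by (intro sum.cong) auto
  then show ?thesis using assms by (simp add: lnorm_def powr_powr)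
qed

text \<open>The mixed norms of the three test matrices are
  \<open>n powr (1 / r\<^sub>1 + 1 / r\<^sub>2)\<close> for Hadamard,
  \<open>n powr (1 / r\<^sub>1)\<close> for a single row of ones and
  \<open>n powr (1 / r\<^sub>2)\<close> for the identity. Dividing by the bounds on the form norms
  gives the exponents.\<close>

lemma M_sup_optimal_exponents:
  fixes p q :: ereal
  assumes p: "2 < p" and q: "2 \<le> q" and r: "0 < r\<^sub>1" "0 < r\<^sub>2"
  defines "M \<equiv> M_sup TYPE('k::{real_normed_field, real_inner}) p q r\<^sub>1 r\<^sub>2"
  shows "optimal_exponent M (1 / r\<^sub>1 + 1 / r\<^sub>2 - (3 / 2 - (recip p + recip q)))"
    and "optimal_exponent M (1 / r\<^sub>1 - (1 - recip q))"
    and "optimal_exponent M (1 / r\<^sub>2 - (1 - recip p - recip q))"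
proof -
  have pq: "1 \<le> p" "1 \<le> q"
    using p q by (auto intro: order_trans[of 1 "2::ereal"] order_trans[OF _ less_imp_le])
  note ab = recip_ge_0[OF pq(1)] recip_less_half[OF p] recip_ge_0[OF pq(2)] recip_le_half[OF q]
  show "optimal_exponent M (1 / r\<^sub>1 + 1 / r\<^sub>2 - (3 / 2 - (recip p + recip q)))"
  proof (rule optimal_exponentI)
    fix k
    define n where "n = (2 ^ k :: nat)"
    have "1 \<in> {1..n}" by (simp add: n_def)
    moreover have "bounded_on_weights {1..n} {1..n} (recip p) (recip q)
        (\<lambda>i j. of_real (walsh k i j) :: 'k) (real n powr (3 / 2 - (recip p + recip q)))"
      unfolding n_def using ab by (intro bounded_on_weights_walsh) auto
    moreover have "of_real (walsh k 1 1) \<noteq> (0 :: 'k)" by (metis abs_walsh abs_zero of_real_eq_0_iff zero_neq_one)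
    ultimately have "lnorm r\<^sub>2 {1..n} (\<lambda>i. lnorm r\<^sub>1 {1..n} (\<lambda>j. norm (of_real (walsh k i j) :: 'k)))
        / real n powr (3 / 2 - (recip p + recip q)) \<le> M n"
      unfolding M_def using pq r by (intro M_sup_ge)
    then show "real (2 ^ k) powr (1 / r\<^sub>1 + 1 / r\<^sub>2 - (3 / 2 - (recip p + recip q))) \<le> M (2 ^ k)"
      using r by (simp add: lnorm_const powr_add powr_diff mult.commute n_def)
  qed
  show "optimal_exponent M (1 / r\<^sub>1 - (1 - recip q))"
  proof (rule optimal_exponentI)
    fix k
    define n where "n = (2 ^ k :: nat)"
    have n: "1 \<le> n" by (simp add: n_def)
    then have "1 \<in> {1..n}" by simp
    moreover have "bounded_on_weights {1..n} {1..n} (recip p) (recip q)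
        (\<lambda>i j. if i = 1 then 1 else 0 :: 'k) (real n powr (1 - recip q))"
      using ab n by (intro bounded_on_weights_row) auto
    ultimately have "lnorm r\<^sub>2 {1..n} (\<lambda>i. lnorm r\<^sub>1 {1..n} (\<lambda>j. norm (if i = 1 then 1 else 0 :: 'k)))
        / real n powr (1 - recip q) \<le> M n"
      unfolding M_def using pq r by (intro M_sup_ge) auto
    moreover have "(\<lambda>i. lnorm r\<^sub>1 {1..n} (\<lambda>j. norm (if i = (1::nat) then 1 else 0 :: 'k)))
        = (\<lambda>i. if i = 1 then real n powr (1 / r\<^sub>1) else 0)"
      using r by (auto simp: lnorm_const fun_eq_iff)
    ultimately show "real (2 ^ k) powr (1 / r\<^sub>1 - (1 - recip q)) \<le> M (2 ^ k)"
      using r n by (simp add: lnorm_single powr_diff n_def)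
  qed
  show "optimal_exponent M (1 / r\<^sub>2 - (1 - recip p - recip q))"
  proof (rule optimal_exponentI)
    fix k
    define n where "n = (2 ^ k :: nat)"
    have "1 \<in> {1..n}" by (simp add: n_def)
    moreover have "bounded_on_weights {1..n} {1..n} (recip p) (recip q)
        (\<lambda>i j. if i = j then 1 else 0 :: 'k) (real n powr (1 - recip p - recip q))"
      using ab by (intro bounded_on_weights_diagonal) auto
    ultimately have "lnorm r\<^sub>2 {1..n} (\<lambda>i. lnorm r\<^sub>1 {1..n} (\<lambda>j. norm (if i = j then 1 else 0 :: 'k)))
        / real n powr (1 - recip p - recip q) \<le> M n"
      unfolding M_def using pq r by (intro M_sup_ge) auto
    moreover have "lnorm r\<^sub>1 {1..n} (\<lambda>j. norm (if i = j then 1 else 0 :: 'k)) = 1" if "i \<in> {1..n}" for i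
    proof -
      have "(\<lambda>j. norm (if i = j then 1 else 0 :: 'k)) = (\<lambda>j. if j = i then 1 else 0)" by auto
      then show ?thesis using lnorm_single[of "{1..n}" i r\<^sub>1 1] that r by simp
    qed
    then have "lnorm r\<^sub>2 {1..n} (\<lambda>i. lnorm r\<^sub>1 {1..n} (\<lambda>j. norm (if i = j then 1 else 0 :: 'k)))
        = lnorm r\<^sub>2 {1..n} (\<lambda>i. 1)"
      by (intro lnorm_cong)
    ultimately show "real (2 ^ k) powr (1 / r\<^sub>2 - (1 - recip p - recip q)) \<le> M (2 ^ k)"
      using r by (simp add: lnorm_const powr_diff n_def)
  qed
qed

text \<open>The sort covers \<open>real\<close> and \<open>complex\<close> together; its real inner
  product supports the parallelogram arguments behind Khinchine and the Hadamard matrices.\<close>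

lemma M_sup_regions:
  fixes p q :: ereal and r\<^sub>1 r\<^sub>2 :: real
  assumes p: "2 < p" and q: "2 \<le> q" and r: "r\<^sub>1 > 0" "r\<^sub>2 > 0"
  defines "M \<equiv> M_sup TYPE('k::{real_normed_field, real_inner}) p q r\<^sub>1 r\<^sub>2"
  shows "(region_R1 p q r\<^sub>1 r\<^sub>2 \<or> region_R2 p q r\<^sub>1 r\<^sub>2 \<longrightarrow>
            power_bound M (1 / r\<^sub>1 + 1 / r\<^sub>2 - (3 / 2 - (recip p + recip q))) \<and>
            optimal_exponent M (1 / r\<^sub>1 + 1 / r\<^sub>2 - (3 / 2 - (recip p + recip q)))) \<and>
         (region_R3 p q r\<^sub>1 r\<^sub>2 \<longrightarrow>
            power_bound M (1 / r\<^sub>1 - recip (conj_exponent q)) \<and>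
            optimal_exponent M (1 / r\<^sub>1 - recip (conj_exponent q))) \<and>
         (region_R4 p q r\<^sub>1 r\<^sub>2 \<longrightarrow>
            power_bound M (1 / r\<^sub>2 - (1 - recip p - recip q)) \<and>
            optimal_exponent M (1 / r\<^sub>2 - (1 - recip p - recip q)))"
proof -
  have pq: "1 \<le> p" "1 \<le> q"
    using p q by (auto intro: order_trans[of 1 "2::ereal"] order_trans[OF _ less_imp_le])
  define a b where "a = recip p" and "b = recip q"
  have ab: "0 \<le> a" "a < 1 / 2" "0 \<le> b" "b \<le> 1 / 2"
    using recip_ge_0[OF pq(1)] recip_less_half[OF p] recip_ge_0[OF pq(2)] recip_le_half[OF q]
    by (auto simp: a_def b_def)
  note opt = M_sup_optimal_exponents[where 'k = 'k, OF p q r, folded M_def a_def b_def]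
  note ub = M_sup_power_bound_max[where 'k = 'k, OF p q r, folded M_def a_def b_def]
  have conj: "conj_exponent q = ereal (1 / (1 - b))" "recip (conj_exponent q) = 1 - b"
    using conj_exponent_eq[OF q] ab by (auto simp: b_def)
  have R1: "power_bound M (1 / r\<^sub>1 + 1 / r\<^sub>2 - (3 / 2 - (a + b)))" if "region_R1 p q r\<^sub>1 r\<^sub>2"
  proof -
    have R: "1 / (1 - b) \<le> r\<^sub>1" "r\<^sub>1 \<le> 2" "1 / r\<^sub>1 + 1 / r\<^sub>2 > 3 / 2 - (a + b)"
      using that by (auto simp: region_R1_def conj a_def b_def)
    then have "1 / 2 \<le> 1 / r\<^sub>1" "1 / r\<^sub>1 \<le> 1 - b"
      using r ab by (auto simp: field_simps)
    \<comment> \<open>With \<open>s = r\<^sub>1\<close> the inner exponent does not move, and the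
      third condition of the region makes the outer cost positive.\<close>
    from ub[OF r(1) this] R(3) show ?thesis by (simp add: max_def algebra_simps)
  qed
  have R2: "power_bound M (1 / r\<^sub>1 + 1 / r\<^sub>2 - (3 / 2 - (a + b)))" if "region_R2 p q r\<^sub>1 r\<^sub>2"
  proof -
    have "r\<^sub>1 < 1 / (1 - b)" "r\<^sub>2 < 1 / (1 / 2 - a)"
      using that by (auto simp: region_R2_def conj a_def)
    then have R: "1 - b < 1 / r\<^sub>1" "1 / 2 - a < 1 / r\<^sub>2"
      using r ab by (auto simp: field_simps)
    \<comment> \<open>With \<open>s\<close> the conjugate exponent of \<open>q\<close> both costs
      are positive and add up.\<close>
    from ub[of "1 / (1 - b)"] ab R show ?thesis by (simp add: max_def algebra_simps)
  qed
  have R3: "power_bound M (1 / r\<^sub>1 - (1 - b))" if "region_R3 p q r\<^sub>1 r\<^sub>2"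
  proof -
    have "r\<^sub>1 < 1 / (1 - b)" "r\<^sub>2 > 1 / (1 / 2 - a)"
      using that by (auto simp: region_R3_def conj a_def)
    then have R: "1 - b < 1 / r\<^sub>1" "1 / r\<^sub>2 < 1 / 2 - a"
      using r ab by (auto simp: field_simps)
    \<comment> \<open>The same endpoint, but \<open>r\<^sub>2\<close> exceeds the outer exponent
      there, so only the inner cost remains.\<close>
    from ub[of "1 / (1 - b)"] ab R show ?thesis by (simp add: max_def algebra_simps)
  qed
  have R4: "power_bound M (1 / r\<^sub>2 - (1 - a - b))" if "region_R4 p q r\<^sub>1 r\<^sub>2"
  proof -
    have "2 < r\<^sub>1" "r\<^sub>2 < 1 / (1 - a - b)"
      using that by (auto simp: region_R4_def a_def b_def)
    then have R: "1 / r\<^sub>1 < 1 / 2" "1 - a - b < 1 / r\<^sub>2"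
      using r ab by (auto simp: field_simps)
    \<comment> \<open>At the endpoint \<open>s = 2\<close> the inner exponent grows at no cost and
      only the outer cost remains.\<close>
    from ub[of 2] ab R show ?thesis by (simp add: max_def algebra_simps)
  qed
  show ?thesis
    using opt R1 R2 R3 R4 unfolding conj(2) a_def[symmetric] b_def[symmetric] by blast
qed

theorem proposition6p1:
  fixes p q :: ereal and r\<^sub>1 r\<^sub>2 :: real and M :: "nat \<Rightarrow> real"
  assumes "2 < p" and "2 \<le> q" and "r\<^sub>1 > 0" and "r\<^sub>2 > 0"
    and "M = M_sup TYPE(real) p q r\<^sub>1 r\<^sub>2 \<or> M = M_sup TYPE(complex) p q r\<^sub>1 r\<^sub>2"
  shows "(region_R1 p q r\<^sub>1 r\<^sub>2 \<or> region_R2 p q r\<^sub>1 r\<^sub>2 \<longrightarrow>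
            power_bound M (1 / r\<^sub>1 + 1 / r\<^sub>2 - (3 / 2 - (recip p + recip q))) \<and>
            optimal_exponent M (1 / r\<^sub>1 + 1 / r\<^sub>2 - (3 / 2 - (recip p + recip q)))) \<and>
         (region_R3 p q r\<^sub>1 r\<^sub>2 \<longrightarrow>
            power_bound M (1 / r\<^sub>1 - recip (conj_exponent q)) \<and>
            optimal_exponent M (1 / r\<^sub>1 - recip (conj_exponent q))) \<and>
         (region_R4 p q r\<^sub>1 r\<^sub>2 \<longrightarrow>
            power_bound M (1 / r\<^sub>2 - (1 - recip p - recip q)) \<and>
            optimal_exponent M (1 / r\<^sub>2 - (1 - recip p - recip q)))"
  using assms M_sup_regions[where 'k = real] M_sup_regions[where 'k = complex] by blast

end
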